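(* Let $\mathcal{G}^1_T$ be the connected component of the root $1$ in $\mathcal{G}_T$; it equals all of $\mathcal{G}_T$ iff $\Sigma_T\not\le\Gamma=\mathrm{PSL}_2\mathbb{Z}$. Assume that $\mathcal{G}^1_T$ is synchronizing. Then the set of irrationals $\alpha>0$ whose $\Sigma_T$-equivalence class is partitioned in more than one tail-equivalence class (of $T$-symbolic orbits) has Lebesgue measure $0$.
   Context: $T$ is a slow continued fraction algorithm on $[0,\infty]$ with inverse branches $A_a=B_aF^{e(a)}$ in $\mathrm{PGL}_2\mathbb{Z}$, $\Sigma_T=\langle A_0,\dots,A_{n-1}\rangle$. $\mathcal{G}_T$ is the deterministic transducer with input alphabet $\{L,N\}$ obtained from the graph of $T$ (two copies of the finite binary tree of left factors of the $B_a$ in the free monoid on $L=\begin{bmatrix}1&0\\1&1\end{bmatrix}$, $N=\begin{bmatrix}1&1\\0&1\end{bmatrix}$, twins differing by $F=\begin{bmatrix}0&1\\1&0\end{bmatrix}$, leaves glued to the root $1$ and its twin $2$ according to $e(a)$) by removing the $F$-edges; on input the Farey/$\{L,N\}$-coding of $\alpha$ it outputs the $T$-symbolic orbit of $\alpha$. A synchronizing word is an input word $W$ with $vW=uW$ for all states $u,v$ (of the component considered). *)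

theory Defs
  imports "HOL-Analysis.Analysis" "HOL-Algebra.Generated_Groups" "HOL-Library.Sublist"
begin

definition GL2Z :: "(int^2^2) monoid" where
  "GL2Z = \<lparr>carrier = {M. \<bar>det M\<bar> = 1}, mult = (**), one = mat 1\<rparr>"

definition PGL2Z :: "(int^2^2) set monoid" where
  "PGL2Z = GL2Z Mod {mat 1, - mat 1}"

definition pgl :: "int^2^2 \<Rightarrow> (int^2^2) set" where
  "pgl M = {mat 1, - mat 1} #>\<^bsub>GL2Z\<^esub> M"

definition PSL2Z :: "(int^2^2) set set" where
  "PSL2Z = pgl ` {M. det M = 1}"

text \<open>The projective line over the reals is represented by the extended
  reals other than \<open>-\<infinity>\<close>, the interval \<open>[0,\<infinity>]\<close> by \<open>{0..}\<close>.\<close>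

definition proj_action :: "int^2^2 \<Rightarrow> ereal \<Rightarrow> ereal" where
  "proj_action M x =
    (let a = real_of_int (M$1$1); b = real_of_int (M$1$2);
         c = real_of_int (M$2$1); d = real_of_int (M$2$2); r = real_of_ereal x
     in if x = \<infinity> then (if c = 0 then \<infinity> else ereal (a / c))
        else if c * r + d = 0 then \<infinity> else ereal ((a * r + b) / (c * r + d)))"

text \<open>Elements of the free monoid generated by the matrices \<open>L\<close> and \<open>N\<close> are represented
  by the corresponding words.\<close>

datatype letter = L | N

definition matF :: "int^2^2" where
  "matF = vector [vector [0, 1], vector [1, 0]]"

fun letter_mat :: "letter \<Rightarrow> int^2^2" where
  "letter_mat L = vector [vector [1, 0], vector [1, 1]]"
| "letter_mat N = vector [vector [1, 1], vector [0, 1]]"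

definition word_mat :: "letter list \<Rightarrow> int^2^2" where
  "word_mat w = foldr (\<lambda>x M. letter_mat x ** M) w (mat 1)"

text \<open>The data of an algorithm: the number \<open>n\<close> of branches, the words \<open>B\<^sub>a\<close>, and the exponents
  \<open>e(a)\<close> in \<open>{0,1}\<close>, coded as truth values. Only indices \<open>a < n\<close> are relevant.\<close>

record slow_cf =
  num :: nat
  Bword :: "nat \<Rightarrow> letter list"
  expo :: "nat \<Rightarrow> bool"

definition branch :: "slow_cf \<Rightarrow> nat \<Rightarrow> int^2^2" where
  "branch T a = word_mat (Bword T a) ** (if expo T a then matF else mat 1)"

definition piece :: "slow_cf \<Rightarrow> nat \<Rightarrow> ereal set" where
  "piece T a = proj_action (branch T a) ` {0..}"

definition is_slow_cf :: "slow_cf \<Rightarrow> bool" where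
  "is_slow_cf T \<longleftrightarrow> 2 \<le> num T
     \<and> (\<Union>a<num T. piece T a) = {0..}
     \<and> (\<forall>a<num T. \<forall>b<num T. a \<noteq> b \<longrightarrow> interior (piece T a) \<inter> interior (piece T b) = {})"

text \<open>At the finitely many common endpoints of two pieces, the piece of smaller index is used;
  the orbits of irrational points do not meet these endpoints.\<close>

definition piece_index :: "slow_cf \<Rightarrow> ereal \<Rightarrow> nat" where
  "piece_index T x = (LEAST a. a < num T \<and> x \<in> piece T a)"

definition cf_map :: "slow_cf \<Rightarrow> ereal \<Rightarrow> ereal" where
  "cf_map T x = proj_action (matrix_inv (branch T (piece_index T x))) x"

definition symbolic_orbit :: "slow_cf \<Rightarrow> ereal \<Rightarrow> nat \<Rightarrow> nat" where
  "symbolic_orbit T x t = piece_index T ((cf_map T ^^ t) x)"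

definition pos_irrationals :: "real set" where
  "pos_irrationals = {\<alpha>. 0 < \<alpha> \<and> \<alpha> \<notin> \<rat>}"

definition tail_equiv :: "slow_cf \<Rightarrow> real rel" where
  "tail_equiv T = {(\<alpha>, \<beta>). \<alpha> \<in> pos_irrationals \<and> \<beta> \<in> pos_irrationals
     \<and> (\<exists>h k. \<forall>t. symbolic_orbit T (ereal \<alpha>) (h + t) = symbolic_orbit T (ereal \<beta>) (k + t))}"

definition Sigma_grp :: "slow_cf \<Rightarrow> (int^2^2) set set" where
  "Sigma_grp T = generate PGL2Z ((\<lambda>a. pgl (branch T a)) ` {..<num T})"

text \<open>Symbolic orbits exist only in \<open>[0,\<infinity>]\<close>, so equivalence classes are taken among the
  positive irrationals.\<close>

definition Sigma_equiv :: "slow_cf \<Rightarrow> real rel" where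
  "Sigma_equiv T = {(\<alpha>, \<beta>). \<alpha> \<in> pos_irrationals \<and> \<beta> \<in> pos_irrationals
     \<and> (\<exists>S\<in>Sigma_grp T. \<exists>M\<in>S. ereal \<beta> = proj_action M (ereal \<alpha>))}"

text \<open>A node \<open>(w, s)\<close> of the two trees stands for \<open>word_mat w\<close> if \<open>s\<close> is false, and for its twin
  \<open>word_mat w ** matF\<close> if \<open>s\<close> is true; the root \<open>1\<close> and its twin \<open>2\<close> are \<open>([], False)\<close> and
  \<open>([], True)\<close>. Every node is replaced by its representative in the glued graph: the leaf
  \<open>B\<^sub>a\<close> becomes the root \<open>1\<close> if \<open>e(a) = 0\<close> and \<open>2\<close> if \<open>e(a) = 1\<close>, and conversely for
  its twin. The second component is the output emitted on arrival.\<close>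

type_synonym state = "letter list \<times> bool"

definition glue :: "slow_cf \<Rightarrow> state \<Rightarrow> state \<times> nat list" where
  "glue T = (\<lambda>(w, s).
     if \<exists>a<num T. w = Bword T a
     then (let a = (THE a. a < num T \<and> w = Bword T a) in (([], s \<noteq> expo T a), [a]))
     else ((w, s), []))"

definition states :: "slow_cf \<Rightarrow> state set" where
  "states T = {fst (glue T (w, s)) | w s. \<exists>a<num T. prefix w (Bword T a)}"

fun swap_letter :: "letter \<Rightarrow> letter" where
  "swap_letter L = N"
| "swap_letter N = L"

text \<open>Because of \<open>F L = N F\<close> and \<open>F N = L F\<close>, the letter labels are exchanged in the twin tree.\<close>

definition transition :: "slow_cf \<Rightarrow> state \<Rightarrow> letter \<Rightarrow> state \<times> nat list" where
  "transition T = (\<lambda>(w, s) x. glue T (w @ [if s then swap_letter x else x], s))"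

definition run :: "slow_cf \<Rightarrow> state \<Rightarrow> letter list \<Rightarrow> state" where
  "run T u W = foldl (\<lambda>v x. fst (transition T v x)) u W"

definition edges :: "slow_cf \<Rightarrow> state rel" where
  "edges T = {(u, v). u \<in> states T \<and> (\<exists>x. v = fst (transition T u x))}"

definition root_component :: "slow_cf \<Rightarrow> state set" where
  "root_component T = {v. (([], False), v) \<in> (edges T \<union> (edges T)\<inverse>)\<^sup>*}"

definition synchronizing :: "slow_cf \<Rightarrow> state set \<Rightarrow> bool" where
  "synchronizing T C \<longleftrightarrow> (\<exists>W. \<forall>u\<in>C. \<forall>v\<in>C. run T u W = run T v W)"

end

(*
  The Farey coding of a positive irrational is read by the transducer; being in state (w, s) with
  unread tail z means that the T-orbit has reached the point w F^s z. If M in PGL_2(Z) maps alpha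
  to beta, then for a long prefix P of the coding of alpha all entries of M P have the same sign,
  so M P = Q F^e for a word Q and the codings of alpha and beta have a common tail up to the twin
  involution, with e = 0 if all branches have determinant 1. Once the synchronizing word
  W occurs in that tail, both runs are in the same state, hence the two T-orbits merge. So the
  exceptional points have codings containing W only finitely often. This set is null: on cylinders whose
  matrix has a balanced bottom row, the word W takes up a fixed proportion, such
  cylinders shrink to almost every point, and outer regularity gives a contradiction to
  positive measure.
*)
theory Submission
  imports Defs
begin

text \<open>The Farey map has parabolic fixed points at 0 and \<infinity>, so compositions of its
  inverse branches have no uniform distortion bound; long blocks of one letter are the obstacle.
  Every irrational coding changes letter infinitely often, however, and a word ending in
  \<open>NL\<close> has a bottom row (c, d) with d \<le> c \<le> 2 d. The length of its cylinder is
  1 / (c d), so one constant \<theta> < 1 bounds the part that \<open>W\<close> leaves uncovered in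
  all these cylinders. Twin states are the second obstacle. A matrix of determinant -1 leaves the
  tails of \<alpha> and \<beta> related by F, so the state reached by \<beta> has to be replaced by
  its twin, and synchronization applies only if this twin lies in the component of the root. The
  determinant decides this: such a matrix occurs in the group only if some e(a) = 1, and exactly
  then the component is the whole graph. The first claim of the theorem is thus an ingredient of the
  second.\<close>

subsection \<open>Farey coding\<close>

fun letter_act :: "letter \<Rightarrow> real \<Rightarrow> real" where
  "letter_act L y = y / (y + 1)"
| "letter_act N y = y + 1"

definition word_act :: "letter list \<Rightarrow> real \<Rightarrow> real" where
  "word_act w y = foldr letter_act w y"

text \<open>At 1 the letter \<open>N\<close> is a default value: an irrational orbit never reaches
  1.\<close>

definition digit :: "real \<Rightarrow> letter" where
  "digit x = (if x < 1 then L else N)"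

definition farey :: "real \<Rightarrow> real" where
  "farey x = (if x < 1 then x / (1 - x) else x - 1)"

fun code :: "real \<Rightarrow> nat \<Rightarrow> letter list" where
  "code x 0 = []"
| "code x (Suc k) = digit x # code (farey x) k"

lemma word_act_simps [simp]:
  "word_act [] y = y"
  "word_act (x # w) y = letter_act x (word_act w y)"
  "word_act (v @ w) y = word_act v (word_act w y)"
  by (simp_all add: word_act_def)

lemma length_code [simp]: "length (code x k) = k"
  by (induction k arbitrary: x) auto

lemma code_add: "code x (j + k) = code x j @ code ((farey ^^ j) x) k"
  by (induction j arbitrary: x) (simp_all add: funpow_swap1)

lemma code_Suc_right: "code x (Suc k) = code x k @ [digit ((farey ^^ k) x)]"
  using code_add[of x k 1] by simp

lemma take_code: "j \<le> k \<Longrightarrow> take j (code x k) = code x j"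
  using code_add[of x j "k - j"] by simp

lemma prefix_code: "j \<le> k \<Longrightarrow> prefix (code x j) (code x k)"
  by (metis take_code take_is_prefix)

section \<open>Irrationality under rational Moebius maps\<close>

lemma Rats_mult_cancel: "r \<in> \<rat> \<Longrightarrow> r \<noteq> 0 \<Longrightarrow> r * x \<in> \<rat> \<Longrightarrow> (x::real) \<in> \<rat>"
  by (metis Rats_divide nonzero_mult_div_cancel_left)

lemma rat_affine_irrational:
  fixes x :: real
  assumes "x \<notin> \<rat>" "c \<in> \<rat>" "d \<in> \<rat>" "c * x + d \<in> \<rat>"
  shows "c = 0"
  using Rats_mult_cancel[of c x] Rats_diff[of "c * x + d" d] assms by auto

text \<open>A rational value q would give the relation (a - q c) x + (b - q d) = 0; for irrational x
  both coefficients vanish, hence a d = b c. A zero denominator is excluded in the same way.\<close>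

lemma moebius_irrational:
  fixes x :: real
  assumes x: "x \<notin> \<rat>" and r: "a \<in> \<rat>" "b \<in> \<rat>" "c \<in> \<rat>" "d \<in> \<rat>" and det: "a * d - b * c \<noteq> 0"
  shows "(a * x + b) / (c * x + d) \<notin> \<rat>" "c * x + d \<noteq> 0"
proof -
  show nz: "c * x + d \<noteq> 0"
    using rat_affine_irrational[OF x r(3,4)] det by fastforce
  show "(a * x + b) / (c * x + d) \<notin> \<rat>"
  proof
    define q where "q = (a * x + b) / (c * x + d)"
    assume "(a * x + b) / (c * x + d) \<in> \<rat>"
    hence q: "q \<in> \<rat>" by (simp add: q_def)
    have "a * x + b = q * (c * x + d)" using nz by (simp add: q_def)
    hence e: "(a - q * c) * x + (b - q * d) = 0" by (simp add: algebra_simps)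
    hence "a - q * c = 0" using rat_affine_irrational[OF x, of "a - q * c" "b - q * d"] q r by auto
    moreover from this e have "b - q * d = 0" by simp
    ultimately show False using det by (simp add: algebra_simps)
  qed
qed

lemma letter_act_irrational [simp]:
  "y \<in> pos_irrationals \<Longrightarrow> letter_act x y \<in> pos_irrationals"
  using moebius_irrational(1)[of y 1 0 1 1] moebius_irrational(1)[of y 1 1 0 1]
  by (cases x) (auto simp: pos_irrationals_def)

lemma word_act_irrational [simp]:
  "y \<in> pos_irrationals \<Longrightarrow> word_act w y \<in> pos_irrationals"
  by (induction w) auto

lemma farey_irrational [simp]:
  assumes "x \<in> pos_irrationals" shows "farey x \<in> pos_irrationals"
proof -
  have "x \<noteq> 1" using assms by (auto simp: pos_irrationals_def)
  then show ?thesis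
    using assms moebius_irrational(1)[of x 1 0 "-1" 1] moebius_irrational(1)[of x 1 "-1" 0 1]
    by (auto simp: pos_irrationals_def farey_def field_simps)
qed

lemma funpow_farey_irrational [simp]:
  "x \<in> pos_irrationals \<Longrightarrow> (farey ^^ k) x \<in> pos_irrationals"
  by (induction k) auto

lemma inverse_irrational: "x \<in> pos_irrationals \<Longrightarrow> 1 / x \<in> pos_irrationals"
  using moebius_irrational(1)[of x 0 1 1 0] by (auto simp: pos_irrationals_def)

lemma letter_act_digit: "x \<in> pos_irrationals \<Longrightarrow> letter_act (digit x) (farey x) = x"
  by (auto simp: pos_irrationals_def digit_def farey_def field_simps)

lemma digit_farey_letter_act:
  "y \<in> pos_irrationals \<Longrightarrow> digit (letter_act x y) = x \<and> farey (letter_act x y) = y"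
  by (cases x) (auto simp: pos_irrationals_def digit_def farey_def field_simps)

lemma word_act_code: "x \<in> pos_irrationals \<Longrightarrow> word_act (code x k) ((farey ^^ k) x) = x"
  by (induction k arbitrary: x) (simp_all add: funpow_swap1 letter_act_digit)

lemma code_word_act:
  "y \<in> pos_irrationals \<Longrightarrow>
    code (word_act w y) (length w) = w \<and> (farey ^^ length w) (word_act w y) = y"
  by (induction w) (simp_all add: funpow_swap1 digit_farey_letter_act)

text \<open>A concrete irrational tail: placed behind a word it yields a point whose coding begins
  with that word, through which properties of the pieces become properties of the words.\<close>

lemma sqrt2_pos_irrational: "sqrt 2 \<in> pos_irrationals"
proof -
  have False if rat: "sqrt 2 \<in> \<rat>"
  proof -
    obtain m n where mn: "n \<noteq> 0" "\<bar>sqrt 2\<bar> = real m / real n" "coprime m n"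
      using Rats_abs_nat_div_natE[OF rat] by blast
    hence "real m = sqrt 2 * n" by simp
    hence "(real m)\<^sup>2 = 2 * (real n)\<^sup>2" by (simp add: power_mult_distrib)
    hence eq: "m\<^sup>2 = 2 * n\<^sup>2" by (metis of_nat_eq_iff of_nat_mult of_nat_numeral of_nat_power)
    hence "even m" by (metis dvd_triv_left even_power)
    then obtain k where "m = 2 * k" by blast
    hence "n\<^sup>2 = 2 * k\<^sup>2" using eq by (simp add: power2_eq_square)
    hence "even n" by (metis dvd_triv_left even_power)
    with \<open>even m\<close> mn(3) show False using coprime_common_divisor[of m n 2] by simp
  qed
  then show ?thesis by (auto simp: pos_irrationals_def)
qed

subsection \<open>Words as matrices\<close>

abbreviation wa :: "letter list \<Rightarrow> int" where "wa w \<equiv> word_mat w $ 1 $ 1"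
abbreviation wb :: "letter list \<Rightarrow> int" where "wb w \<equiv> word_mat w $ 1 $ 2"
abbreviation wc :: "letter list \<Rightarrow> int" where "wc w \<equiv> word_mat w $ 2 $ 1"
abbreviation wd :: "letter list \<Rightarrow> int" where "wd w \<equiv> word_mat w $ 2 $ 2"

lemmas mat2_simps = matrix_matrix_mult_def sum_2 vector_2 mat_def

lemma word_mat_Nil [simp]: "word_mat [] = mat 1"
  by (simp add: word_mat_def)

lemma word_mat_Cons [simp]: "word_mat (x # w) = letter_mat x ** word_mat w"
  by (simp add: word_mat_def)

lemma word_mat_append: "word_mat (v @ w) = word_mat v ** word_mat w"
  by (induction v) (simp_all add: matrix_mul_assoc)

lemma det_letter_mat [simp]: "det (letter_mat x) = 1"
  by (cases x) (simp_all add: det_2 vector_2)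

lemma det_word_mat [simp]: "det (word_mat w) = 1"
  by (induction w) (simp_all add: det_mul)

lemma word_det: "wa w * wd w - wb w * wc w = 1"
  using det_word_mat[of w] by (simp add: det_2)

lemma word_det_real: "real_of_int (wa w) * wd w - real_of_int (wb w) * wc w = 1"
  using arg_cong[OF word_det[of w], of real_of_int] by simp

lemma word_nonneg: "0 \<le> wa w" "0 \<le> wb w" "0 \<le> wc w" "0 \<le> wd w"
proof -
  have "0 \<le> wa w \<and> 0 \<le> wb w \<and> 0 \<le> wc w \<and> 0 \<le> wd w"
  proof (induction w)
    case (Cons x w) then show ?case by (cases x) (simp_all add: mat2_simps)
  qed (simp add: mat2_simps)
  then show "0 \<le> wa w" "0 \<le> wb w" "0 \<le> wc w" "0 \<le> wd w" by auto
qed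

text \<open>Right multiplication by a letter adds one column to the other, so the bottom row can be
  followed letter by letter along a coding.\<close>

lemma word_entries_snoc:
  "wc (w @ [L]) = wc w + wd w" "wd (w @ [L]) = wd w"
  "wc (w @ [N]) = wc w" "wd (w @ [N]) = wc w + wd w"
  by (simp_all add: word_mat_append mat2_simps)

lemma wd_pos: "1 \<le> wd w"
proof (induction w rule: rev_induct)
  case (snoc x w)
  then show ?case using word_nonneg(3)[of w] by (cases x) (simp_all add: word_entries_snoc)
qed (simp add: mat2_simps)

lemma wa_pos: "1 \<le> wa w"
  using word_det[of w] word_nonneg[of w] by (smt (verit) mult_nonneg_nonneg mult_eq_0_iff)

lemma word_denom_pos:
  fixes y :: real
  shows "0 < y \<Longrightarrow> 0 < real_of_int (wc w) * y + real_of_int (wd w)"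
  using wd_pos[of w] word_nonneg(3)[of w]
  by (intro add_nonneg_pos mult_nonneg_nonneg) auto

lemma word_act_moebius:
  fixes y :: real
  shows "0 < y \<Longrightarrow> word_act w y = (wa w * y + wb w) / (wc w * y + wd w)"
proof (induction w)
  case (Cons x w)
  note p = word_denom_pos[OF Cons.prems, of w]
  have p': "0 < real_of_int (wc (x # w)) * y + real_of_int (wd (x # w))" by (rule word_denom_pos[OF Cons.prems])
  have q: "0 \<le> real_of_int (wa w) * y + real_of_int (wb w)"
    using word_nonneg[of w] Cons.prems by simp
  show ?case
  proof (cases x)
    case N then show ?thesis using p p' Cons by (simp add: mat2_simps field_simps)
  next
    case L
    have eq: "t / u / (t / u + 1) = t / (t + u)" if "0 < u" "0 \<le> t" for t u :: real
      using that by (simp add: field_simps)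
    show ?thesis using L Cons eq[OF p q] by (simp add: mat2_simps algebra_simps)
  qed
qed (simp add: mat2_simps)

text \<open>Euclidean algorithm on rows. If the top row dominates the bottom row entrywise, a factor
  \<open>N\<close> splits off on the left, in the opposite case a factor \<open>L\<close>; the entry
  sum drops because both diagonal entries are at least 1. Without domination, determinant 1 leaves
  only the identity matrix.\<close>

lemma nonneg_unimodular_word:
  fixes a b c d :: int
  assumes "0 \<le> a" "0 \<le> b" "0 \<le> c" "0 \<le> d" "a * d - b * c = 1"
  shows "\<exists>w. wa w = a \<and> wb w = b \<and> wc w = c \<and> wd w = d"
  using assms
proof (induction "nat (a + b + c + d)" arbitrary: a b c d rule: less_induct)
  case less
  have ad: "1 \<le> a" "1 \<le> d"
    using less.prems by (smt (verit) mult_nonneg_nonneg mult_eq_0_iff)+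
  consider "c \<le> a" "d \<le> b" | "a \<le> c" "b \<le> d" | "c < a" "b < d" | "a < c" "d < b" by linarith
  then show ?case
  proof cases
    case 1
    have "\<exists>w. wa w = a - c \<and> wb w = b - d \<and> wc w = c \<and> wd w = d"
      using 1 less.prems ad by (intro less.hyps) (auto simp: algebra_simps)
    then obtain w where "wa w = a - c" "wb w = b - d" "wc w = c" "wd w = d" by blast
    then show ?thesis by (intro exI[of _ "N # w"]) (simp add: mat2_simps)
  next
    case 2
    have "\<exists>w. wa w = a \<and> wb w = b \<and> wc w = c - a \<and> wd w = d - b"
      using 2 less.prems ad by (intro less.hyps) (auto simp: algebra_simps)
    then obtain w where "wa w = a" "wb w = b" "wc w = c - a" "wd w = d - b" by blast
    then show ?thesis by (intro exI[of _ "L # w"]) (simp add: mat2_simps)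
  next
    case 3
    have "(c + 1) * (b + 1) \<le> a * d" using 3 less.prems by (intro mult_mono) auto
    hence "b = 0" "c = 0" using less.prems by (auto simp: algebra_simps)
    moreover from this have "a = 1" "d = 1" using less.prems
      by (auto simp: pos_zmult_eq_1_iff ad zmult_eq_1_iff)
    ultimately show ?thesis by (intro exI[of _ "[]"]) (simp add: mat2_simps)
  next
    case 4
    have "a * d \<le> c * b" using 4 less.prems by (intro mult_mono) auto
    then show ?thesis using less.prems by (simp add: algebra_simps)
  qed
qed

subsection \<open>Growth of denominators\<close>

text \<open>Inversion is the action of F, which exchanges the letters; the occurrence of
  \<open>N\<close> will follow from that of \<open>L\<close>.\<close>

lemma digit_inverse: "x \<in> pos_irrationals \<Longrightarrow> digit (1 / x) = swap_letter (digit x)"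
  by (auto simp: pos_irrationals_def digit_def field_simps)

lemma farey_inverse: "x \<in> pos_irrationals \<Longrightarrow> farey (1 / x) = 1 / farey x"
  by (auto simp: pos_irrationals_def farey_def field_simps)

lemma funpow_farey_inverse: "x \<in> pos_irrationals \<Longrightarrow> (farey ^^ k) (1 / x) = 1 / (farey ^^ k) x"
  by (induction k) (simp_all add: farey_inverse)

text \<open>As long as the letter is \<open>N\<close>, each step subtracts 1, which cannot go on
  forever for a positive number.\<close>

lemma exists_digit_L:
  assumes "x \<in> pos_irrationals" shows "\<exists>k. digit ((farey ^^ k) x) = L"
proof (rule ccontr)
  assume "\<not> ?thesis"
  hence n: "\<not> (farey ^^ k) x < 1" for k by (auto simp: digit_def split: if_splits)
  have "(farey ^^ k) x = x - k" for k
  proof (induction k)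
    case (Suc k)
    have "(farey ^^ Suc k) x = (farey ^^ k) x - 1" using n[of k] by (simp add: farey_def)
    then show ?case using Suc by simp
  qed simp
  moreover obtain k where "x < real k" using reals_Archimedean2 by blast
  ultimately show False using n[of k] by simp
qed

lemma exists_digit:
  assumes "x \<in> pos_irrationals" shows "\<exists>k. digit ((farey ^^ k) x) = l"
proof (cases l)
  case L then show ?thesis using exists_digit_L[OF assms] by simp
next
  case N
  obtain k where "digit ((farey ^^ k) (1 / x)) = L"
    using exists_digit_L[OF inverse_irrational[OF assms]] by blast
  hence "swap_letter (digit ((farey ^^ k) x)) = L"
    using assms by (simp add: funpow_farey_inverse digit_inverse)
  then show ?thesis using N by (metis swap_letter.elims)
qed

lemma code_ends_NL:
  assumes "x \<in> pos_irrationals" shows "\<exists>k\<ge>m. \<exists>w. code x k = w @ [N, L]"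
proof -
  let ?d = "\<lambda>k. digit ((farey ^^ k) x)"
  obtain i where "digit ((farey ^^ i) ((farey ^^ m) x)) = N"
    using exists_digit[of "(farey ^^ m) x"] assms by auto
  hence i: "?d (i + m) = N" by (simp add: funpow_add)
  obtain j where "digit ((farey ^^ j) ((farey ^^ (i + m)) x)) = L"
    using exists_digit[of "(farey ^^ (i + m)) x"] assms by auto
  hence j: "?d (j + (i + m)) = L" by (simp add: funpow_add)
  \<comment> \<open>The first \<open>L\<close> after the chosen \<open>N\<close>: the letter just
    before it is again an \<open>N\<close>.\<close>
  define q where "q = (LEAST q. ?d (q + (i + m)) = L)"
  have q: "?d (q + (i + m)) = L" unfolding q_def by (rule LeastI[of _ j]) (rule j)
  have "q \<noteq> 0" using q i by (metis add_0 letter.distinct(1))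
  then obtain p where p: "q = Suc p" by (cases q) auto
  have "?d (p + (i + m)) \<noteq> L" using not_less_Least[of p "\<lambda>q. ?d (q + (i + m)) = L"] p q_def by auto
  hence "?d (p + (i + m)) = N" using letter.exhaust by blast
  hence "code x (Suc (Suc (p + (i + m)))) = code x (p + (i + m)) @ [N, L]"
    using q p by (simp only: code_Suc_right) simp
  then show ?thesis by (intro exI[of _ "Suc (Suc (p + (i + m)))"]) auto
qed

text \<open>The product grows by the square of \<open>wd w\<close> (letter \<open>L\<close>) or of
  \<open>wc w\<close> (letter \<open>N\<close>). The latter is 0 for words without \<open>L\<close>,
  hence the case distinction.\<close>

lemma denominators_snoc:
  "wc w * wd w + (if wc w = 0 then 0 else 1) \<le> wc (w @ [x]) * wd (w @ [x])" "wc w \<le> wc (w @ [x])"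
proof -
  have c: "0 \<le> wc w" and d: "1 \<le> wd w" using word_nonneg wd_pos by auto
  show "wc w \<le> wc (w @ [x])" using c d by (cases x) (auto simp: word_entries_snoc)
  have "1 \<le> wd w * wd w" using mult_mono[of 1 "wd w" 1 "wd w"] d by simp
  moreover have "1 \<le> wc w * wc w" if "wc w \<noteq> 0" using mult_mono[of 1 "wc w" 1 "wc w"] c that by simp
  ultimately show "wc w * wd w + (if wc w = 0 then 0 else 1) \<le> wc (w @ [x]) * wd (w @ [x])"
    by (cases x) (auto simp: word_entries_snoc algebra_simps)
qed

text \<open>The product is the inverse length of the cylinder, so the cylinders around an irrational
  point shrink to it. Once an \<open>L\<close> has occurred, each further letter adds at least
  1.\<close>

lemma denominators_unbounded:
  assumes "x \<in> pos_irrationals"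
  shows "\<exists>k0. \<forall>k\<ge>k0. wc (code x k) \<ge> 1 \<and> wc (code x k) * wd (code x k) \<ge> m"
proof -
  let ?c = "\<lambda>k. wc (code x k)" and ?d = "\<lambda>k. wd (code x k)"
  obtain k1 w where k1: "code x k1 = w @ [N, L]" using code_ends_NL[OF assms] by blast
  have "w @ [N, L] = (w @ [N]) @ [L]" by simp
  hence "1 \<le> ?c k1" unfolding k1
    using word_nonneg(3)[of "w @ [N]"] wd_pos[of "w @ [N]"] by (simp only: word_entries_snoc)
  hence *: "1 \<le> ?c (k1 + j) \<and> int j \<le> ?c (k1 + j) * ?d (k1 + j)" for j
  proof (induction j)
    case 0 then show ?case using word_nonneg[of "code x k1"] by simp
  next
    case (Suc j)
    then show ?case
      using denominators_snoc[of "code x (k1 + j)" "digit ((farey ^^ (k1 + j)) x)"]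
      by (simp add: code_Suc_right del: code.simps) 
  qed
  show ?thesis
  proof (intro exI[of _ "k1 + nat m"] allI impI)
    fix k assume k: "k1 + nat m \<le> k"
    show "1 \<le> ?c k \<and> m \<le> ?c k * ?d k" using *[of "k - k1"] k by simp linarith
  qed
qed

subsection \<open>Equivalent numbers have a common tail\<close>

text \<open>The power of F with exponent \<open>s\<close>, acting on the positive reals.\<close>

definition flip :: "bool \<Rightarrow> real \<Rightarrow> real" where
  "flip s z = (if s then 1 / z else z)"

text \<open>Here (p, q) is a row of M, and the conclusions concern its products with the columns of
  the matrix of \<open>w\<close>. Since a / c and b / d are the endpoints of the cylinder, the
  errors d (a - c \<alpha>) and c (d \<alpha> - b) lie in [0, 1]; so both products inherit the sign
  of p \<alpha> + q once c d is large.\<close>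

lemma approx_sign:
  fixes \<alpha> \<xi> :: real and p q :: int
  assumes "0 < \<xi>" and \<alpha>: "\<alpha> = word_act w \<xi>" and c: "1 \<le> wc w"
    and big: "real_of_int \<bar>p\<bar> < wc w * wd w * (p * \<alpha> + q)"
  shows "0 \<le> p * wa w + q * wc w" "0 \<le> p * wb w + q * wd w"
proof -
  define a b c d where "a = real_of_int (wa w)" and "b = real_of_int (wb w)"
    and "c = real_of_int (wc w)" and "d = real_of_int (wd w)"
  have pos: "1 \<le> c" "1 \<le> d" using wd_pos[of w] assms by (auto simp: c_def d_def)
  have den: "0 < c * \<xi> + d" using pos \<open>0 < \<xi>\<close> by (simp add: add_nonneg_pos)
  have det: "a * d = 1 + b * c" using word_det_real[of w] by (simp add: a_def b_def c_def d_def)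
  have \<alpha>': "\<alpha> = (a * \<xi> + b) / (c * \<xi> + d)"
    using \<alpha> \<open>0 < \<xi>\<close> by (simp add: word_act_moebius a_def b_def c_def d_def)
  have e1: "a - c * \<alpha> = 1 / (c * \<xi> + d)" using den det unfolding \<alpha>' by (simp add: field_simps)
  have e2: "d * \<alpha> - b = \<xi> / (c * \<xi> + d)" using den det unfolding \<alpha>' by (simp add: field_simps)
  have b1: "0 \<le> a - c * \<alpha>" "d * (a - c * \<alpha>) \<le> 1" unfolding e1 using den pos \<open>0 < \<xi>\<close> by (auto simp: field_simps)
  have b2: "0 \<le> d * \<alpha> - b" "c * (d * \<alpha> - b) \<le> 1" unfolding e2 using den pos \<open>0 < \<xi>\<close> by (auto simp: field_simps)
  have big': "\<bar>real_of_int p\<bar> < c * d * (p * \<alpha> + q)" using big by (simp add: c_def d_def)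
  have "d * (p * a + q * c) = c * d * (p * \<alpha> + q) + p * (d * (a - c * \<alpha>))" by (simp add: algebra_simps)
  moreover have "\<bar>p * (d * (a - c * \<alpha>))\<bar> \<le> \<bar>real_of_int p\<bar> * 1"
    unfolding abs_mult using b1 pos by (intro mult_left_mono) (auto simp: abs_mult)
  ultimately have "0 < d * (p * a + q * c)" using big' by linarith
  hence "0 < p * a + q * c" using pos by (simp add: zero_less_mult_iff)
  hence "0 < real_of_int (p * wa w + q * wc w)" by (simp add: a_def c_def)
  thus "0 \<le> p * wa w + q * wc w" by linarith
  have "c * (p * b + q * d) = c * d * (p * \<alpha> + q) - p * (c * (d * \<alpha> - b))" by (simp add: algebra_simps)
  moreover have "\<bar>p * (c * (d * \<alpha> - b))\<bar> \<le> \<bar>real_of_int p\<bar> * 1"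
    unfolding abs_mult using b2 pos by (intro mult_left_mono) (auto simp: abs_mult)
  ultimately have "0 < c * (p * b + q * d)" using big' by linarith
  hence "0 < p * b + q * d" using pos by (simp add: zero_less_mult_iff)
  hence "0 < real_of_int (p * wb w + q * wd w)" by (simp add: b_def d_def)
  thus "0 \<le> p * wb w + q * wd w" by linarith
qed

lemma common_tail_pos:
  fixes \<alpha> \<beta> :: real and p q r s :: int
  assumes \<alpha>: "\<alpha> \<in> pos_irrationals" and \<beta>: "0 < \<beta>" "\<beta> = (p * \<alpha> + q) / (r * \<alpha> + s)"
    and pos: "0 < r * \<alpha> + s" and det: "\<bar>p * s - q * r\<bar> = 1"
  shows "\<exists>k Q. \<beta> = word_act Q (flip (p * s - q * r = -1) ((farey ^^ k) \<alpha>))"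
proof -
  define t u where "t = p * \<alpha> + q" and "u = r * \<alpha> + s"
  have tu: "0 < t" "0 < u" using \<beta> pos by (auto simp: t_def u_def zero_less_divide_iff)
  obtain m :: nat where m: "(\<bar>p\<bar> + \<bar>r\<bar> + 1) / min t u < real m" using reals_Archimedean2 by blast
  obtain k where k: "wc (code \<alpha> k) \<ge> 1" "wc (code \<alpha> k) * wd (code \<alpha> k) \<ge> int m"
    using denominators_unbounded[OF \<alpha>] by blast
  define P \<xi> where "P = code \<alpha> k" and "\<xi> = (farey ^^ k) \<alpha>"
  have \<xi>: "0 < \<xi>" using \<alpha> funpow_farey_irrational[OF \<alpha>, of k] by (simp add: \<xi>_def pos_irrationals_def)
  have \<alpha>P: "\<alpha> = word_act P \<xi>" using word_act_code[OF \<alpha>] by (simp add: P_def \<xi>_def)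
  have big: "real_of_int (\<bar>p\<bar> + \<bar>r\<bar> + 1) < wc P * wd P * min t u"
  proof -
    have "real_of_int (\<bar>p\<bar> + \<bar>r\<bar> + 1) < real m * min t u" using m tu by (simp add: field_simps)
    also have "\<dots> \<le> real_of_int (wc P * wd P) * min t u"
      using k tu unfolding P_def by (intro mult_right_mono) (linarith | simp)+
    finally show ?thesis by simp
  qed
  have cd: "0 \<le> real_of_int (wc P * wd P)" using word_nonneg[of P] by simp
  have "wc P * wd P * min t u \<le> wc P * wd P * t" "wc P * wd P * min t u \<le> wc P * wd P * u"
    using cd by (intro mult_left_mono; simp)+
  hence "real_of_int \<bar>p\<bar> < wc P * wd P * (p * \<alpha> + q)" "real_of_int \<bar>r\<bar> < wc P * wd P * (r * \<alpha> + s)"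
    using big unfolding t_def[symmetric] u_def[symmetric] by simp_all
  note nn = approx_sign[OF \<xi> \<alpha>P k(1)[folded P_def] this(1)] approx_sign[OF \<xi> \<alpha>P k(1)[folded P_def] this(2)]
  \<comment> \<open>The entries of M P, for M with rows (p, q) and (r, s).\<close>
  define X1 X2 Y1 Y2 where "X1 = p * wa P + q * wc P" and "X2 = p * wb P + q * wd P"
    and "Y1 = r * wa P + s * wc P" and "Y2 = r * wb P + s * wd P"
  have nn: "0 \<le> X1" "0 \<le> X2" "0 \<le> Y1" "0 \<le> Y2" using nn by (simp_all add: X1_def X2_def Y1_def Y2_def)
  have "X1 * Y2 - X2 * Y1 = (p * s - q * r) * (wa P * wd P - wb P * wc P)"
    by (simp add: X1_def X2_def Y1_def Y2_def algebra_simps)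
  hence D: "X1 * Y2 - X2 * Y1 = p * s - q * r" by (simp add: word_det)
  define den where "den = wc P * \<xi> + wd P"
  have den: "0 < den" unfolding den_def by (rule word_denom_pos[OF \<xi>])
  have "\<alpha> * den = wa P * \<xi> + wb P" using \<alpha>P den \<xi> by (simp add: word_act_moebius den_def)
  hence "p * (\<alpha> * den) + q * den = X1 * \<xi> + X2" "r * (\<alpha> * den) + s * den = Y1 * \<xi> + Y2"
    by (simp_all add: X1_def X2_def Y1_def Y2_def den_def algebra_simps)
  hence "(p * \<alpha> + q) * den = X1 * \<xi> + X2" "(r * \<alpha> + s) * den = Y1 * \<xi> + Y2"
    by (simp_all add: algebra_simps)
  moreover have "\<beta> = ((p * \<alpha> + q) * den) / ((r * \<alpha> + s) * den)" using \<beta> den by simp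
  ultimately have \<beta>X: "\<beta> = (X1 * \<xi> + X2) / (Y1 * \<xi> + Y2)" by simp
  show ?thesis
  proof (cases "p * s - q * r = 1")
    case True
    then obtain Q where "wa Q = X1" "wb Q = X2" "wc Q = Y1" "wd Q = Y2"
      using nonneg_unimodular_word[OF nn(1,2,3,4)] D by auto
    hence "\<beta> = word_act Q \<xi>" using \<xi> \<beta>X by (simp add: word_act_moebius)
    then show ?thesis using True by (intro exI[of _ k] exI[of _ Q]) (simp add: flip_def \<xi>_def)
  next
    \<comment> \<open>Determinant -1: multiplying M P by F on the right exchanges the columns and
      gives determinant 1. Hence M P = Q F, which acts on \<xi> as Q does on 1 / \<xi>.\<close>
    case False
    hence F: "p * s - q * r = -1" using det by linarith
    hence "X2 * Y1 - X1 * Y2 = 1" using D by simp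
    then obtain Q where "wa Q = X2" "wb Q = X1" "wc Q = Y2" "wd Q = Y1"
      using nonneg_unimodular_word[OF nn(2,1,4,3)] by auto
    hence "word_act Q (1 / \<xi>) = (X2 * (1 / \<xi>) + X1) / (Y2 * (1 / \<xi>) + Y1)" using \<xi> by (simp add: word_act_moebius)
    also have "\<dots> = ((X2 * (1 / \<xi>) + X1) * \<xi>) / ((Y2 * (1 / \<xi>) + Y1) * \<xi>)" using \<xi> by simp
    also have "\<dots> = \<beta>" unfolding \<beta>X using \<xi> by (simp add: distrib_right add.commute)
    finally show ?thesis using F by (intro exI[of _ k] exI[of _ Q]) (simp add: flip_def \<xi>_def)
  qed
qed

lemma common_tail:
  fixes \<alpha> \<beta> :: real and p q r s :: int
  assumes \<alpha>: "\<alpha> \<in> pos_irrationals" and \<beta>: "0 < \<beta>" "\<beta> = (p * \<alpha> + q) / (r * \<alpha> + s)"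
    and det: "\<bar>p * s - q * r\<bar> = 1"
  shows "\<exists>k Q. \<beta> = word_act Q (flip (p * s - q * r = -1) ((farey ^^ k) \<alpha>))"
proof (cases "0 < r * \<alpha> + s")
  case True then show ?thesis using common_tail_pos assms by blast
next
  case False
  \<comment> \<open>M and -M act alike, so the sign may be changed; a zero denominator would mean
    \<beta> = 0 by the convention on division.\<close>
  hence "0 < (-r) * \<alpha> + (-s)" using \<beta> by (cases "r * \<alpha> + s = 0") auto
  moreover have "\<beta> = ((-p) * \<alpha> + (-q)) / ((-r) * \<alpha> + (-s))"
    unfolding \<beta>(2) using minus_divide_divide[of "p * \<alpha> + q" "r * \<alpha> + s"] by simp
  ultimately show ?thesis using common_tail_pos[OF \<alpha> \<beta>(1), of "-p" "-q" "-r" "-s"] det by simp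
qed

subsection \<open>Cylinders\<close>

definition cyl :: "letter list \<Rightarrow> real set" where
  "cyl w = {x \<in> pos_irrationals. code x (length w) = w}"

text \<open>An interval with endpoints b / d and a / c; the cross-multiplied form also covers c = 0,
  where the right endpoint is infinite.\<close>

definition word_interval :: "letter list \<Rightarrow> real set" where
  "word_interval w = {x. wb w < wd w * x \<and> wc w * x < wa w}"

lemma word_act_interval: "word_act w ` {0<..} = word_interval w"
proof (intro subset_antisym subsetI)
  fix x assume "x \<in> word_act w ` {0<..}"
  then obtain y where y: "0 < y" and x: "x = word_act w y" by auto
  note p = word_denom_pos[OF y, of w]
  have "wd w * x - wb w = (wa w * wd w - wb w * wc w) * y / (wc w * y + wd w)"
    using p y by (simp add: x word_act_moebius field_simps)
  moreover have "wa w - wc w * x = (wa w * wd w - wb w * wc w) / (wc w * y + wd w)"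
    using p y by (simp add: x word_act_moebius field_simps)
  ultimately have "0 < wd w * x - wb w" "0 < wa w - wc w * x"
    using p y by (simp_all add: word_det_real)
  then show "x \<in> word_interval w" by (simp add: word_interval_def)
next
  fix x assume "x \<in> word_interval w"
  hence p: "0 < wd w * x - wb w" "0 < wa w - wc w * x" by (simp_all add: word_interval_def)
  \<comment> \<open>The quotient u / v is the inverse Moebius map at x: the inverse matrix has rows
    (d, -b) and (-c, a).\<close>
  define u v where "u = wd w * x - wb w" and "v = wa w - wc w * x"
  have uv: "0 < u" "0 < v" using p by (simp_all add: u_def v_def)
  have "wa w * u + wb w * v = (wa w * wd w - wb w * wc w) * x"
    "wc w * u + wd w * v = (wa w * wd w - wb w * wc w)"
    by (simp_all add: u_def v_def algebra_simps)
  hence e: "wa w * u + wb w * v = x" "wc w * u + wd w * v = 1" by (simp_all add: word_det_real)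
  have "word_act w (u / v) = (wa w * (u / v) + wb w) / (wc w * (u / v) + wd w)"
    using uv by (intro word_act_moebius) simp
  also have "\<dots> = ((wa w * (u / v) + wb w) * v) / ((wc w * (u / v) + wd w) * v)" using uv by simp
  also have "\<dots> = x" using uv e by (simp add: distrib_right)
  finally show "x \<in> word_act w ` {0<..}" using uv by (intro image_eqI[of _ _ "u / v"]) auto
qed

lemma word_act_preimage_irrational:
  assumes "0 < y" "word_act w y \<in> pos_irrationals" shows "y \<in> pos_irrationals"
proof -
  have "y \<notin> \<rat>"
  proof
    assume "y \<in> \<rat>"
    hence "word_act w y \<in> \<rat>" unfolding word_act_moebius[OF assms(1)] by auto
    thus False using assms(2) by (simp add: pos_irrationals_def)
  qed
  thus ?thesis using assms(1) by (simp add: pos_irrationals_def)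
qed

lemma cyl_eq: "cyl w = word_interval w \<inter> pos_irrationals"
proof (intro subset_antisym subsetI)
  fix x assume x: "x \<in> cyl w"
  hence "x = word_act w ((farey ^^ length w) x)"
    using word_act_code[of x "length w"] by (simp add: cyl_def)
  moreover have "0 < (farey ^^ length w) x"
    using x funpow_farey_irrational[of x "length w"] by (simp add: cyl_def pos_irrationals_def)
  ultimately show "x \<in> word_interval w \<inter> pos_irrationals"
    using x unfolding word_act_interval[symmetric] by (auto simp: cyl_def)
next
  fix x assume x: "x \<in> word_interval w \<inter> pos_irrationals"
  then obtain y where "0 < y" "x = word_act w y" unfolding word_act_interval[symmetric] by auto
  then show "x \<in> cyl w"
    using x word_act_preimage_irrational[of y w] code_word_act[of y w] by (auto simp: cyl_def)
qed

lemma open_word_interval: "open (word_interval w)"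
  unfolding word_interval_def Collect_conj_eq
  by (intro open_Int open_Collect_less continuous_intros)

lemma pos_irrationals_borel [measurable]: "pos_irrationals \<in> sets borel"
proof -
  have eq: "pos_irrationals = {0<..} - \<rat>" by (auto simp: pos_irrationals_def)
  have "\<rat> \<in> sets (borel :: real measure)" by (rule sets.countable[OF _ countable_rat]) simp
  then show ?thesis unfolding eq by (intro sets.Diff) auto
qed

lemma cyl_borel [measurable]: "cyl w \<in> sets borel"
  unfolding cyl_eq using open_word_interval by simp

lemma word_interval_Ioo:
  assumes "1 \<le> wc w"
  shows "word_interval w = {wb w / wd w <..< wa w / wc w}"
  using assms wd_pos[of w] by (auto simp: word_interval_def field_simps)

lemma word_interval_length:
  assumes "1 \<le> wc w"
  shows "real_of_int (wa w) / wc w - wb w / wd w = 1 / (wc w * wd w)"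
  using assms wd_pos[of w] word_det_real[of w] by (simp add: field_simps)

lemma emeasure_cyl:
  assumes "1 \<le> wc w"
  shows "emeasure lborel (cyl w) = ennreal (1 / (wc w * wd w))"
proof -
  have "x > 0" if "x \<in> word_interval w" for x
  proof -
    have "0 < wd w * x" using that word_nonneg(2)[of w] by (auto simp: word_interval_def)
    then show ?thesis using wd_pos[of w] by (simp add: zero_less_mult_iff)
  qed
  hence "cyl w = word_interval w - \<rat>" by (auto simp: cyl_eq pos_irrationals_def)
  hence "emeasure lborel (cyl w) = emeasure lborel (word_interval w)"
    using emeasure_Diff_null_set[OF countable_imp_null_set_lborel[OF countable_rat], of "word_interval w"]
      open_word_interval[of w] by simp
  also have "\<dots> = ennreal (real_of_int (wa w) / wc w - wb w / wd w)"
    unfolding word_interval_Ioo[OF assms]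
    by (rule emeasure_lborel_Ioo) (use word_interval_length[OF assms] assms wd_pos[of w] in \<open>smt (verit) divide_nonneg_nonneg mult_nonneg_nonneg of_int_0_le_iff\<close>)
  finally show ?thesis by (simp add: word_interval_length[OF assms])
qed

lemma cyl_dist:
  assumes "1 \<le> wc w" "x \<in> cyl w" "y \<in> cyl w"
  shows "\<bar>x - y\<bar> < 1 / (wc w * wd w)"
proof -
  have "x \<in> {wb w / wd w <..< wa w / wc w}" "y \<in> {wb w / wd w <..< wa w / wc w}"
    using assms unfolding cyl_eq word_interval_Ioo[OF assms(1), symmetric] by auto
  thus ?thesis unfolding word_interval_length[OF assms(1), symmetric] by auto
qed

lemma cyl_append:
  "cyl (v @ w) = {x \<in> cyl v. code ((farey ^^ length v) x) (length w) = w}"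
  by (auto simp: cyl_def code_add)

lemma countable_letter_lists: "countable (A :: letter list set)"
proof -
  have "UNIV = {L, N}" using letter.exhaust by auto
  hence "countable (UNIV :: letter set)" by (metis countable_finite finite.simps)
  hence "countable (lists (UNIV :: letter set))" by (rule countable_lists)
  thus ?thesis by (rule countable_subset[rotated]) simp
qed

text \<open>On a cylinder with balanced bottom row, the Moebius map has bounded distortion, so that
  each fixed word occupies a fixed proportion of it.\<close>

definition balanced :: "letter list \<Rightarrow> bool" where
  "balanced w \<longleftrightarrow> 1 \<le> wc w \<and> wc w \<le> 2 * wd w \<and> wd w \<le> 2 * wc w"

lemma balanced_NL: "balanced (w @ [N, L])"
proof -
  have "w @ [N, L] = (w @ [N]) @ [L]" by simp
  then show ?thesis using word_nonneg(3)[of w] wd_pos[of w]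
    by (simp only: balanced_def word_entries_snoc) auto
qed

lemma balanced_loss:
  "\<exists>\<theta>. 0 \<le> \<theta> \<and> \<theta> < 1 \<and>
    (\<forall>P. balanced P \<longrightarrow> emeasure lborel (cyl P - cyl (P @ W)) \<le> ennreal \<theta> * emeasure lborel (cyl P))"
proof -
  \<comment> \<open>The bottom row of P W is (c, d) times the matrix of \<open>W\<close>. By d \<le>
    2 c and c \<le> 2 d its entries are at most c (\<open>wa W\<close> + 2 \<open>wc W\<close>) and
    d (2 \<open>wb W\<close> + \<open>wd W\<close>), so \<open>cyl (P @ W)\<close> fills at least
    the fraction 1 / K of \<open>cyl P\<close>.\<close>
  define K where "K = real_of_int ((wa W + 2 * wc W) * (2 * wb W + wd W))"
  have "1 * 1 \<le> (wa W + 2 * wc W) * (2 * wb W + wd W)"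
    using word_nonneg[of W] wa_pos[of W] wd_pos[of W] by (intro mult_mono) auto
  hence K: "1 \<le> K" unfolding K_def by linarith
  show ?thesis
  proof (intro exI[of _ "1 - 1 / K"] conjI allI impI)
    show "0 \<le> 1 - 1 / K" "1 - 1 / K < 1" using K by auto
    fix P assume P: "balanced P"
    define c d where "c = wc P" and "d = wd P"
    have cd: "1 \<le> c" "1 \<le> d" "c \<le> 2 * d" "d \<le> 2 * c"
      using P wd_pos by (auto simp: balanced_def c_def d_def)
    define c' d' where "c' = wc (P @ W)" and "d' = wd (P @ W)"
    have c': "c' = c * wa W + d * wc W" and d': "d' = c * wb W + d * wd W"
      by (simp_all add: c'_def d'_def c_def d_def word_mat_append mat2_simps)
    note nn = word_nonneg[of W]
    have "c * 1 \<le> c * wa W" using wa_pos[of W] cd by (intro mult_left_mono) auto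
    hence c'1: "1 \<le> c'" using cd nn unfolding c' by (smt (verit) mult_nonneg_nonneg)
    have d'1: "1 \<le> d'" unfolding d'_def by (rule wd_pos)
    have "d * wc W \<le> (2 * c) * wc W" using cd nn by (intro mult_right_mono) auto
    hence 1: "c' \<le> c * (wa W + 2 * wc W)" unfolding c' by (simp add: algebra_simps)
    have "c * wb W \<le> (2 * d) * wb W" using cd nn by (intro mult_right_mono) auto
    hence 2: "d' \<le> d * (2 * wb W + wd W)" unfolding d' by (simp add: algebra_simps)
    have "c' * d' \<le> (c * (wa W + 2 * wc W)) * (d * (2 * wb W + wd W))"
      using 1 2 c'1 d'1 by (intro mult_mono) auto
    hence "real_of_int (c' * d') \<le> real_of_int ((c * (wa W + 2 * wc W)) * (d * (2 * wb W + wd W)))"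
      by (simp only: of_int_le_iff)
    also have "\<dots> = K * (real_of_int c * real_of_int d)" by (simp add: K_def)
    finally have le: "real_of_int c' * real_of_int d' \<le> K * (real_of_int c * real_of_int d)" by simp
    have cdp: "0 < real_of_int c * real_of_int d" "0 < real_of_int c' * real_of_int d'"
      using cd c'1 d'1 by simp_all
    have "1 / (K * (real_of_int c * real_of_int d)) \<le> 1 / (real_of_int c' * real_of_int d')"
      using le cdp by (intro divide_left_mono) (use K in auto)
    hence real: "1 / (real_of_int c * real_of_int d) - 1 / (real_of_int c' * real_of_int d')
        \<le> (1 - 1 / K) * (1 / (real_of_int c * real_of_int d))"
      by (simp only: left_diff_distrib) simp
    have "emeasure lborel (cyl P - cyl (P @ W)) = emeasure lborel (cyl P) - emeasure lborel (cyl (P @ W))"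
      using c'1 by (intro emeasure_Diff) (auto simp: emeasure_cyl c'_def, auto simp: cyl_append)
    also have "\<dots> = ennreal (1 / (real_of_int c * real_of_int d) - 1 / (real_of_int c' * real_of_int d'))"
      using c'1 cd cdp by (subst (1 2) emeasure_cyl)
        (auto simp: c'_def d'_def c_def d_def intro!: ennreal_minus)
    also have "\<dots> \<le> ennreal ((1 - 1 / K) * (1 / (real_of_int c * real_of_int d)))"
      using real by (rule ennreal_leI)
    also have "\<dots> = ennreal (1 - 1 / K) * emeasure lborel (cyl P)"
      using K cdp ennreal_mult[of "1 - 1 / K" "1 / (real_of_int c * real_of_int d)"] emeasure_cyl[of P] cd
      by (simp add: c_def d_def)
    finally show "emeasure lborel (cyl P - cyl (P @ W)) \<le> ennreal (1 - 1 / K) * emeasure lborel (cyl P)" .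
  qed
qed

subsection \<open>Almost every coding contains a given word infinitely often\<close>

text \<open>The threshold \<open>k\<close> splits the points whose coding contains \<open>W\<close>
  only finitely often into countably many sets.\<close>

definition avoiding :: "letter list \<Rightarrow> nat \<Rightarrow> real set" where
  "avoiding W k = {x \<in> pos_irrationals. \<forall>j\<ge>k. code ((farey ^^ j) x) (length W) \<noteq> W}"

lemma avoiding_eq: "avoiding W k = pos_irrationals - (\<Union>P\<in>{P. k \<le> length P}. cyl (P @ W))"
proof (intro subset_antisym subsetI)
  fix x assume "x \<in> avoiding W k"
  then show "x \<in> pos_irrationals - (\<Union>P\<in>{P. k \<le> length P}. cyl (P @ W))"
    by (auto simp: avoiding_def cyl_append)
next
  fix x assume x: "x \<in> pos_irrationals - (\<Union>P\<in>{P. k \<le> length P}. cyl (P @ W))"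
  have "code ((farey ^^ j) x) (length W) \<noteq> W" if "k \<le> j" for j
  proof
    assume "code ((farey ^^ j) x) (length W) = W"
    hence "x \<in> cyl (code x j @ W)" using x by (simp add: cyl_def code_add)
    thus False using x that by auto
  qed
  then show "x \<in> avoiding W k" using x by (simp add: avoiding_def)
qed

lemma avoiding_borel: "avoiding W k \<in> sets borel"
  unfolding avoiding_eq
  by (intro sets.Diff pos_irrationals_borel sets.countable_UN' countable_letter_lists image_subsetI cyl_borel)

text \<open>Infinitely many prefixes end in \<open>NL\<close>, and all long ones have short
  cylinders; this plays the role of a Vitali cover.\<close>

lemma exists_balanced_cyl_subset:
  assumes x: "x \<in> pos_irrationals" and U: "open U" "x \<in> U"
  shows "\<exists>k\<ge>m. balanced (code x k) \<and> cyl (code x k) \<subseteq> U"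
proof -
  obtain e where e: "0 < e" "\<And>y. dist y x < e \<Longrightarrow> y \<in> U" using U by (auto simp: open_dist)
  obtain n :: nat where n: "1 / e < real n" using reals_Archimedean2 by blast
  obtain k0 where k0: "\<And>k. k0 \<le> k \<Longrightarrow> wc (code x k) \<ge> 1 \<and> wc (code x k) * wd (code x k) \<ge> int n"
    using denominators_unbounded[OF x] by blast
  obtain k w where k: "max m k0 \<le> k" "code x k = w @ [N, L]" using code_ends_NL[OF x] by blast
  have "1 \<le> wc (code x k)" "int n \<le> wc (code x k) * wd (code x k)" using k0[of k] k by auto
  hence n': "real n \<le> real_of_int (wc (code x k)) * wd (code x k)" by (metis of_int_le_iff of_int_mult of_int_of_nat_eq)
  have "0 < real n" using n e(1) by (smt (verit) divide_pos_pos)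
  hence "1 / (real_of_int (wc (code x k)) * wd (code x k)) \<le> 1 / n"
    using n' by (intro divide_left_mono) auto
  also have "1 / n < e" using n e \<open>0 < real n\<close> by (simp add: field_simps)
  finally have small: "1 / (real_of_int (wc (code x k)) * wd (code x k)) < e" .
  have "cyl (code x k) \<subseteq> U"
  proof
    fix y assume "y \<in> cyl (code x k)"
    moreover have "x \<in> cyl (code x k)" using x by (simp add: cyl_def)
    ultimately have "dist y x < e"
      using cyl_dist[OF \<open>1 \<le> wc (code x k)\<close>, of y x] small by (simp add: dist_real_def)
    then show "y \<in> U" by (rule e(2))
  qed
  then show ?thesis using k balanced_NL[of w] by (intro exI[of _ k]) auto
qed

text \<open>A covering argument in place of the density theorem: S is covered by disjoint balanced
  cylinders inside U, and in each of them it misses the proportion occupied by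
  \<open>W\<close>.\<close>

lemma emeasure_avoiding_le:
  assumes loss: "\<And>P. balanced P \<Longrightarrow>
      emeasure lborel (cyl P - cyl (P @ W)) \<le> ennreal \<theta> * emeasure lborel (cyl P)"
    and S: "S \<subseteq> avoiding W k" "S \<in> sets borel" and U: "open U" "S \<subseteq> U"
  shows "emeasure lborel S \<le> ennreal \<theta> * emeasure lborel U"
proof -
  define Q where "Q = {P. k \<le> length P \<and> balanced P \<and> cyl P \<subseteq> U}"
  \<comment> \<open>Cylinders are nested or disjoint, so the prefix-minimal words of
    \<open>Q\<close> have disjoint cylinders, which still cover S.\<close>
  define R where "R = {P \<in> Q. \<forall>j<length P. take j P \<notin> Q}"
  have R: "balanced P" "k \<le> length P" "cyl P \<subseteq> U" if "P \<in> R" for P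
    using that by (auto simp: R_def Q_def)
  have no: "False" if "x \<in> cyl P" "x \<in> cyl P'" "P \<in> R" "P' \<in> R" "length P < length P'" for x P P'
  proof -
    have "take (length P) P' = P"
      using that take_code[of "length P" "length P'" x] by (auto simp: cyl_def)
    then show False using that by (auto simp: R_def)
  qed
  have disj: "disjoint_family_on cyl R"
    unfolding disjoint_family_on_def
  proof (intro ballI impI equals0I)
    fix P P' x assume PP: "P \<in> R" "P' \<in> R" "P \<noteq> P'" "x \<in> cyl P \<inter> cyl P'"
    have "P = code x (length P)" "P' = code x (length P')" using PP by (auto simp: cyl_def)
    hence "length P \<noteq> length P'" using PP(3) by metis
    thus False using no[of x P P'] no[of x P' P] PP by fastforce
  qed
  have disjS: "disjoint_family_on (\<lambda>P. cyl P \<inter> S) R"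
    using disj unfolding disjoint_family_on_def by blast
  have cover: "S \<subseteq> (\<Union>P\<in>R. cyl P)"
  proof
    fix x assume x: "x \<in> S"
    hence xi: "x \<in> pos_irrationals" using S by (auto simp: avoiding_def)
    have ex: "\<exists>j. code x j \<in> Q" using exists_balanced_cyl_subset[OF xi U(1), of k] x U by (auto simp: Q_def)
    define j where "j = (LEAST j. code x j \<in> Q)"
    have j: "code x j \<in> Q" unfolding j_def using ex by (rule LeastI_ex)
    have "take i (code x j) \<notin> Q" if "i < j" for i
      using not_less_Least[of i "\<lambda>j. code x j \<in> Q"] that by (simp add: take_code j_def)
    hence "code x j \<in> R" using j by (simp add: R_def)
    moreover have "x \<in> cyl (code x j)" using xi by (simp add: cyl_def)
    ultimately show "x \<in> (\<Union>P\<in>R. cyl P)" by blast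
  qed
  have part: "emeasure lborel (cyl P \<inter> S) \<le> ennreal \<theta> * emeasure lborel (cyl P)" if "P \<in> R" for P
  proof -
    \<comment> \<open>As \<open>P\<close> has length at least \<open>k\<close>, an occurrence of
      \<open>W\<close> right behind it is forbidden in \<open>avoiding W k\<close>.\<close>
    have "cyl P \<inter> S \<subseteq> cyl P - cyl (P @ W)"
      using S(1) R(2)[OF that] by (auto simp: avoiding_eq)
    hence "emeasure lborel (cyl P \<inter> S) \<le> emeasure lborel (cyl P - cyl (P @ W))"
      by (intro emeasure_mono) auto
    also have "\<dots> \<le> ennreal \<theta> * emeasure lborel (cyl P)" by (rule loss[OF R(1)[OF that]])
    finally show ?thesis .
  qed
  have "S = (\<Union>P\<in>R. cyl P \<inter> S)" using cover by auto
  hence "emeasure lborel S = emeasure lborel (\<Union>P\<in>R. cyl P \<inter> S)" by simp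
  also have "\<dots> = (\<integral>\<^sup>+P. emeasure lborel (cyl P \<inter> S) \<partial>count_space R)"
    by (intro emeasure_UN_countable countable_letter_lists disjS) (use S in auto)
  also have "\<dots> \<le> (\<integral>\<^sup>+P. ennreal \<theta> * emeasure lborel (cyl P) \<partial>count_space R)"
    by (intro nn_integral_mono) (use part in auto)
  also have "\<dots> = ennreal \<theta> * (\<integral>\<^sup>+P. emeasure lborel (cyl P) \<partial>count_space R)"
    by (intro nn_integral_cmult) simp
  also have "(\<integral>\<^sup>+P. emeasure lborel (cyl P) \<partial>count_space R) = emeasure lborel (\<Union>P\<in>R. cyl P)"
    by (intro emeasure_UN_countable[symmetric] countable_letter_lists disj) auto
  also have "\<dots> \<le> emeasure lborel U"
    using U R(3) by (intro emeasure_mono) auto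
  finally show ?thesis by (simp add: mult_left_mono)
qed

lemma avoiding_null: "avoiding W k \<in> null_sets lborel"
proof -
  obtain \<theta> where \<theta>: "0 \<le> \<theta>" "\<theta> < 1" and loss: "\<And>P. balanced P \<Longrightarrow>
      emeasure lborel (cyl P - cyl (P @ W)) \<le> ennreal \<theta> * emeasure lborel (cyl P)"
    using balanced_loss by blast
  \<comment> \<open>Bounded parts have finite measure \<mu>, which can be compared with \<theta>
    (\<mu> + e) as a real number.\<close>
  have "avoiding W k \<inter> {..real m} \<in> null_sets lborel" for m
  proof -
    define S where "S = avoiding W k \<inter> {..real m}"
    have S: "S \<in> sets borel" unfolding S_def using avoiding_borel by simp
    have "S \<subseteq> {0..real m}" by (auto simp: S_def avoiding_def pos_irrationals_def)
    hence "emeasure lborel S \<le> emeasure lborel {0..real m}" by (intro emeasure_mono) auto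
    hence "emeasure lborel S < \<infinity>" by (auto simp: ennreal_less_top intro: le_less_trans)
    then obtain \<mu> where \<mu>: "0 \<le> \<mu>" "emeasure lborel S = ennreal \<mu>"
      by (cases "emeasure lborel S") auto
    have "\<mu> = 0"
    proof (rule ccontr)
      assume "\<mu> \<noteq> 0"
      \<comment> \<open>The comparison will give \<mu> (1 - \<theta>) \<le> e, which half of the
        left side contradicts.\<close>
      define e where "e = \<mu> * (1 - \<theta>) / 2"
      have e: "0 < e" using \<open>\<mu> \<noteq> 0\<close> \<mu> \<theta> by (simp add: e_def)
      obtain U where U: "open U" "S \<subseteq> U" "emeasure lborel (U - S) < ennreal e"
        using outer_regular_lborel[OF S e] by blast
      have "ennreal \<mu> \<le> ennreal \<theta> * emeasure lborel U"
        using emeasure_avoiding_le[OF loss _ S U(1,2)] \<mu> by (auto simp: S_def)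
      also have "emeasure lborel U \<le> emeasure lborel S + emeasure lborel (U - S)"
        using emeasure_subadditive[of S lborel "U - S"] S U by (auto simp: Un_absorb1)
      also have "\<dots> \<le> ennreal \<mu> + ennreal e" using U \<mu> by (intro add_mono) auto
      also have "ennreal \<theta> * (ennreal \<mu> + ennreal e) = ennreal (\<theta> * (\<mu> + e))"
        using \<mu> e \<theta> by (simp add: ennreal_mult ennreal_plus)
      finally have "\<mu> \<le> \<theta> * (\<mu> + e)"
        using \<mu> e \<theta> by (auto simp: ennreal_le_iff mult_left_mono)
      moreover have "\<theta> * e \<le> 1 * e" using \<theta> e by (intro mult_right_mono) auto
      ultimately have "\<mu> * (1 - \<theta>) \<le> e" by (simp add: algebra_simps)
      thus False using e unfolding e_def by simp
    qed
    then show ?thesis using S \<mu> unfolding S_def[symmetric] by (auto simp: null_sets_def)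
  qed
  hence "(\<Union>m. avoiding W k \<inter> {..real m}) \<in> null_sets lborel" by blast
  also have "(\<Union>m. avoiding W k \<inter> {..real m}) = avoiding W k"
    using real_arch_simple by auto
  finally show ?thesis .
qed

subsection \<open>The action on irrational points\<close>

lemma proj_action_irrational:
  fixes x :: real
  assumes "x \<notin> \<rat>" "det M \<noteq> 0"
  shows "proj_action M (ereal x) =
      ereal ((M$1$1 * x + M$1$2) / (M$2$1 * x + M$2$2))" "M$2$1 * x + M$2$2 \<noteq> 0"
proof -
  have "real_of_int (M$1$1 * M$2$2 - M$1$2 * M$2$1) \<noteq> 0"
    using assms(2) unfolding det_2 by (simp only: of_int_eq_0_iff) simp
  hence "real_of_int (M$1$1) * M$2$2 - real_of_int (M$1$2) * M$2$1 \<noteq> 0" by simp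
  thus *: "M$2$1 * x + M$2$2 \<noteq> 0"
    using moebius_irrational(2)[OF assms(1), of "M$1$1" "M$1$2" "M$2$1" "M$2$2"] by auto
  show "proj_action M (ereal x) = ereal ((M$1$1 * x + M$1$2) / (M$2$1 * x + M$2$2))"
    using * by (simp add: proj_action_def Let_def)
qed

lemma proj_action_left_inverse:
  fixes y :: real
  assumes "y \<notin> \<rat>" "M' ** M = mat 1"
  shows "proj_action M' (proj_action M (ereal y)) = ereal y"
proof -
  have "det M' * det M = 1" using arg_cong[OF assms(2), of det] by (simp add: det_mul)
  hence dets: "det M \<noteq> 0" "det M' \<noteq> 0" by auto
  define a b c d where "a = real_of_int (M$1$1)" and "b = real_of_int (M$1$2)"
    and "c = real_of_int (M$2$1)" and "d = real_of_int (M$2$2)"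
  define a' b' c' d' where "a' = real_of_int (M'$1$1)" and "b' = real_of_int (M'$1$2)"
    and "c' = real_of_int (M'$2$1)" and "d' = real_of_int (M'$2$2)"
  note defs = a_def b_def c_def d_def a'_def b'_def c'_def d'_def
  have entry: "real_of_int ((M' ** M)$i$j) = real_of_int ((mat 1 :: int^2^2)$i$j)" for i j
    by (simp add: assms(2))
  have e: "a' * a + b' * c = 1" "a' * b + b' * d = 0" "c' * a + d' * c = 0" "c' * b + d' * d = 1"
    using entry[of 1 1] entry[of 1 2] entry[of 2 1] entry[of 2 2]
    by (simp_all add: defs mat2_simps)
  define x where "x = (a * y + b) / (c * y + d)"
  note M = proj_action_irrational[OF assms(1) dets(1), folded a_def b_def c_def d_def]
  have real_det: "a * d - b * c \<noteq> 0"
  proof -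
    have "real_of_int (det M) \<noteq> 0" using dets(1) by simp
    thus ?thesis by (simp add: det_2 defs)
  qed
  have x: "x \<notin> \<rat>" unfolding x_def
    by (rule moebius_irrational(1)[OF assms(1) _ _ _ _ real_det]) (simp_all add: defs)
  note M' = proj_action_irrational[OF x dets(2), folded a'_def b'_def c'_def d'_def]
  have xd: "x * (c * y + d) = a * y + b" using M(2) by (simp add: x_def)
  have "(a' * x + b') * (c * y + d) = a' * (x * (c * y + d)) + b' * (c * y + d)" by (simp add: algebra_simps)
  also have "\<dots> = (a' * a + b' * c) * y + (a' * b + b' * d)" unfolding xd by (simp add: algebra_simps)
  finally have n: "(a' * x + b') * (c * y + d) = y" by (simp add: e)
  have "(c' * x + d') * (c * y + d) = c' * (x * (c * y + d)) + d' * (c * y + d)" by (simp add: algebra_simps)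
  also have "\<dots> = (c' * a + d' * c) * y + (c' * b + d' * d)" unfolding xd by (simp add: algebra_simps)
  finally have dn: "(c' * x + d') * (c * y + d) = 1" by (simp add: e)
  have "(a' * x + b') / (c' * x + d') = ((a' * x + b') * (c * y + d)) / ((c' * x + d') * (c * y + d))"
    using M(2) by simp
  also have "\<dots> = y" by (simp add: n dn)
  finally show ?thesis using M(1) M'(1) by (simp add: x_def)
qed

text \<open>The points 0 and \<infinity> are sent to rational numbers or to \<infinity>, so an
  irrational image excludes both.\<close>

lemma proj_action_irrational_preimage:
  assumes "proj_action M z = ereal x" "x \<notin> \<rat>" "0 \<le> z"
  obtains y where "z = ereal y" "0 < y"
proof (cases z)
  case (real y)
  have "y \<noteq> 0"
  proof
    assume "y = 0"
    hence "x \<in> \<rat>" using assms(1) real by (auto simp: proj_action_def Let_def zero_ereal_def split: if_splits)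
    thus False using assms(2) by simp
  qed
  then show thesis using that real assms(3) by auto
next
  case PInf
  hence "x \<in> \<rat>" using assms(1) by (auto simp: proj_action_def Let_def split: if_splits)
  then show thesis using assms(2) by simp
qed (use assms in auto)

lemma invertible_int_mat2:
  fixes M :: "int^2^2"
  assumes "\<bar>det M\<bar> = 1"
  obtains M' where "M ** M' = mat 1" "M' ** M = mat 1" "det M' = det M"
proof -
  have D: "det M * det M = 1" using assms by (metis abs_mult_self_eq mult_1)
  \<comment> \<open>The adjugate times the determinant, which is its own inverse; in the index type
    \<open>2\<close> the map from i to 3 - i exchanges 1 and 2.\<close>
  define M' :: "int^2^2" where "M' = (\<chi> i j. det M * (if i = j then M$(3 - i)$(3 - j) else - M$i$j))"
  have idx: "(3::2) - 1 = 2" "(3::2) - 2 = 1" by auto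
  have e: "M'$1$1 = det M * M$2$2" "M'$1$2 = - (det M * M$1$2)" "M'$2$1 = - (det M * M$2$1)"
    "M'$2$2 = det M * M$1$1"
    by (simp_all add: M'_def idx)
  have D': "det M * (M$1$1 * M$2$2 - M$1$2 * M$2$1) = 1" using D by (simp only: det_2)
  show thesis
  proof (rule that)
    show "M ** M' = mat 1" "M' ** M = mat 1"
      using D' by (simp_all add: vec_eq_iff forall_2 matrix_matrix_mult_def sum_2 mat_def e algebra_simps)
    have "det M' = (det M * det M) * det M"
      unfolding det_2[of M'] e by (simp add: det_2 algebra_simps)
    then show "det M' = det M" by (simp add: D)
  qed
qed

text \<open>\<open>matrix_inv\<close> chooses some two-sided inverse, so an integral one has to be
  exhibited first.\<close>

lemma matrix_inv_left_int:
  fixes M :: "int^2^2"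
  assumes "\<bar>det M\<bar> = 1" shows "matrix_inv M ** M = mat 1"
proof -
  obtain M' where "M ** M' = mat 1 \<and> M' ** M = mat 1" using invertible_int_mat2[OF assms] by metis
  then show ?thesis unfolding matrix_inv_def by (rule someI2) simp
qed

lemma flip_irrational [simp]: "x \<in> pos_irrationals \<Longrightarrow> flip s x \<in> pos_irrationals"
  by (simp add: flip_def inverse_irrational)

lemma flip_pos [simp]: "0 < x \<Longrightarrow> 0 < flip s x"
  by (simp add: flip_def)

lemma flip_flip: "flip s (flip e x) = flip (s \<noteq> e) x"
  by (auto simp: flip_def)

lemma det_matF: "det matF = -1"
  unfolding det_2 by (simp add: matF_def vector_2)

lemma det_branch: "det (branch T a) = (if expo T a then -1 else 1)"
  by (simp add: branch_def det_mul det_matF)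

lemma proj_action_branch:
  assumes "0 < y"
  shows "proj_action (branch T a) (ereal y) = ereal (word_act (Bword T a) (flip (expo T a) y))"
proof (cases "expo T a")
  case True
  define w where "w = Bword T a"
  have e: "branch T a $1$1 = wb w" "branch T a $1$2 = wa w" "branch T a $2$1 = wd w" "branch T a $2$2 = wc w"
    using True by (simp_all add: branch_def w_def matF_def mat2_simps)
  have "0 < (real_of_int (wc w) * (1 / y) + wd w) * y"
    using word_denom_pos[of "1 / y" w] assms by simp
  hence p: "0 < wc w + wd w * y" using assms by (simp add: distrib_right)
  have "word_act w (1 / y) = (wa w * (1 / y) + wb w) / (wc w * (1 / y) + wd w)"
    using assms by (intro word_act_moebius) simp
  also have "\<dots> = ((wa w * (1 / y) + wb w) * y) / ((wc w * (1 / y) + wd w) * y)" using assms by simp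
  also have "\<dots> = (wb w * y + wa w) / (wd w * y + wc w)" using assms by (simp add: distrib_right add.commute)
  finally show ?thesis using True p by (simp add: proj_action_def Let_def e flip_def w_def[symmetric] add.commute)
next
  case False
  then show ?thesis using assms word_denom_pos[OF assms, of "Bword T a"]
    by (simp add: proj_action_def Let_def branch_def flip_def word_act_moebius)
qed

lemma word_interval_piece: "ereal ` word_interval (Bword T a) \<subseteq> piece T a"
proof
  fix z assume "z \<in> ereal ` word_interval (Bword T a)"
  then obtain y where y: "0 < y" "z = ereal (word_act (Bword T a) y)"
    unfolding word_act_interval[symmetric] by auto
  hence "z = proj_action (branch T a) (ereal (flip (expo T a) y))"
    by (simp add: proj_action_branch flip_flip) (simp add: flip_def)
  then show "z \<in> piece T a" using y flip_pos[of y "expo T a"] unfolding piece_def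
    by (intro image_eqI[of _ _ "ereal (flip (expo T a) y)"]) (auto simp del: flip_pos)
qed

text \<open>The bridge from geometry to words: through it the covering by the pieces says that every
  irrational coding starts with some \<open>Bword T a\<close>, and \<open>piece_index\<close> can be
  read off the coding.\<close>

lemma piece_iff_code:
  assumes "x \<in> pos_irrationals"
  shows "ereal x \<in> piece T a \<longleftrightarrow> code x (length (Bword T a)) = Bword T a"
proof
  assume "ereal x \<in> piece T a"
  then obtain z where z: "0 \<le> z" "proj_action (branch T a) z = ereal x" by (auto simp: piece_def)
  obtain y where y: "z = ereal y" "0 < y"
    using proj_action_irrational_preimage[OF z(2) _ z(1)] assms by (auto simp: pos_irrationals_def)
  have x: "x = word_act (Bword T a) (flip (expo T a) y)"
    using z y by (simp add: proj_action_branch)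
  hence "flip (expo T a) y \<in> pos_irrationals"
    using word_act_preimage_irrational[of "flip (expo T a) y"] y assms by simp
  then show "code x (length (Bword T a)) = Bword T a" using code_word_act x by blast
next
  assume "code x (length (Bword T a)) = Bword T a"
  hence "x \<in> cyl (Bword T a)" using assms by (simp add: cyl_def)
  then show "ereal x \<in> piece T a" using word_interval_piece[of T a] by (auto simp: cyl_eq)
qed

subsection \<open>The transducer follows the map\<close>

lemma prefix_of_common_code: "code x (length v) = v \<Longrightarrow> code x (length w) = w \<Longrightarrow>
    length v \<le> length w \<Longrightarrow> prefix v w"
  using prefix_code[of "length v" "length w" x] by simp

definition internal :: "slow_cf \<Rightarrow> letter list \<Rightarrow> bool" where
  "internal T w \<longleftrightarrow> (\<exists>a<num T. strict_prefix w (Bword T a))"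

text \<open>The point of the orbit under \<open>T\<close> reached in a state, when the unread input codes \<open>z\<close>.\<close>

definition point :: "state \<Rightarrow> real \<Rightarrow> real" where
  "point u z = word_act (fst u) (flip (snd u) z)"

text \<open>The relations F L = N F and F N = L F as maps; they account for the exchanged labels in
  the twin tree.\<close>

lemma flip_letter_act:
  "0 < z \<Longrightarrow> flip s (letter_act x z) = letter_act (if s then swap_letter x else x) (flip s z)"
  by (cases x) (auto simp: flip_def field_simps)

lemma run_Nil [simp]: "run T u [] = u"
  by (simp add: run_def)

lemma run_Cons [simp]: "run T u (x # W) = run T (fst (transition T u x)) W"
  by (simp add: run_def)

lemma run_append: "run T u (V @ W) = run T (run T u V) W"
  by (simp add: run_def)

lemma root_in_component: "([], False) \<in> root_component T"
  by (simp add: root_component_def)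

context
  fixes T :: slow_cf
  assumes T: "is_slow_cf T"
begin

lemma exists_branch:
  assumes "x \<in> pos_irrationals"
  shows "\<exists>a<num T. code x (length (Bword T a)) = Bword T a"
proof -
  have "ereal x \<in> {0..}" using assms by (simp add: pos_irrationals_def)
  then obtain a where "a < num T" "ereal x \<in> piece T a" using T unfolding is_slow_cf_def by blast
  then show ?thesis using piece_iff_code[OF assms] by blast
qed

text \<open>Otherwise an irrational point whose coding starts with the longer word would be interior
  to both pieces.\<close>

lemma Bword_prefix_unique:
  assumes "a < num T" "b < num T" "prefix (Bword T a) (Bword T b)"
  shows "a = b"
proof (rule ccontr)
  assume "a \<noteq> b"
  define x where "x = word_act (Bword T b) (sqrt 2)"
  have x: "x \<in> pos_irrationals" unfolding x_def using sqrt2_pos_irrational by simp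
  have cb: "code x (length (Bword T b)) = Bword T b"
    unfolding x_def using code_word_act[OF sqrt2_pos_irrational] by blast
  obtain v where v: "Bword T b = Bword T a @ v" using assms(3) by (elim prefixE)
  have "code x (length (Bword T a)) = take (length (Bword T a)) (code x (length (Bword T b)))"
    using v by (intro take_code[symmetric]) simp
  also have "\<dots> = Bword T a" unfolding cb by (simp add: v)
  finally have "code x (length (Bword T a)) = Bword T a" .
  hence "x \<in> word_interval (Bword T a)" "x \<in> word_interval (Bword T b)"
    using x cb cyl_eq unfolding cyl_def by blast+
  moreover have "ereal ` word_interval (Bword T c) \<subseteq> interior (piece T c)" for c
    by (intro interior_maximal word_interval_piece open_ereal open_word_interval)
  ultimately have "ereal x \<in> interior (piece T a) \<inter> interior (piece T b)" by blast
  then show False using T assms(1,2) \<open>a \<noteq> b\<close> unfolding is_slow_cf_def by blast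
qed

lemma Bword_nonempty:
  assumes "a < num T" shows "Bword T a \<noteq> []"
proof
  assume e: "Bword T a = []"
  define b where "b = (if a = 0 then 1 else 0 :: nat)"
  have "2 \<le> num T" using T by (simp add: is_slow_cf_def)
  hence "b < num T" "a \<noteq> b" by (auto simp: b_def)
  moreover have "prefix (Bword T a) (Bword T b)" by (simp add: e)
  ultimately show False using Bword_prefix_unique assms by blast
qed

text \<open>Two words that begin the same coding are comparable as prefixes, so the least index is
  the only one.\<close>

lemma piece_index_eq:
  assumes "x \<in> pos_irrationals" "a < num T" "code x (length (Bword T a)) = Bword T a"
  shows "piece_index T (ereal x) = a"
proof -
  have "b = a" if "b < num T" "ereal x \<in> piece T b" for b
  proof -
    have cb: "code x (length (Bword T b)) = Bword T b" using that piece_iff_code assms(1) by blast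
    from nat_le_linear[of "length (Bword T b)" "length (Bword T a)"] show ?thesis
    proof
      assume "length (Bword T b) \<le> length (Bword T a)"
      from prefix_of_common_code[OF cb assms(3) this] show ?thesis
        by (rule Bword_prefix_unique[OF that(1) assms(2)])
    next
      assume "length (Bword T a) \<le> length (Bword T b)"
      from prefix_of_common_code[OF assms(3) cb this] show ?thesis
        by (rule Bword_prefix_unique[OF assms(2) that(1), symmetric])
    qed
  qed
  moreover have "ereal x \<in> piece T a" using assms piece_iff_code by blast
  ultimately show ?thesis unfolding piece_index_def
    using assms(2) by (intro Least_equality) (blast, metis order_refl)
qed

lemma cf_map_word_act:
  assumes y: "y \<in> pos_irrationals" and a: "a < num T"
  shows "cf_map T (ereal (word_act (Bword T a) y)) = ereal (flip (expo T a) y)"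
proof -
  let ?x = "word_act (Bword T a) y" and ?z = "flip (expo T a) y"
  have "piece_index T (ereal ?x) = a"
    using code_word_act[OF y] y a by (intro piece_index_eq) auto
  \<comment> \<open>F is an involution, so B y = (B F^e) (F^e y).\<close>
  moreover have "ereal ?x = proj_action (branch T a) (ereal ?z)"
    using y by (simp add: proj_action_branch flip_flip pos_irrationals_def) (simp add: flip_def)
  moreover have "?z \<notin> \<rat>" using flip_irrational[OF y, of "expo T a"] by (simp add: pos_irrationals_def)
  ultimately show ?thesis
    unfolding cf_map_def
    by (simp add: proj_action_left_inverse matrix_inv_left_int det_branch)
qed

section \<open>Inner nodes and leaves of the glued trees\<close>

lemma glue_leaf: "a < num T \<Longrightarrow> glue T (Bword T a, s) = (([], s \<noteq> expo T a), [a])"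
proof -
  assume a: "a < num T"
  have "(THE b. b < num T \<and> Bword T a = Bword T b) = a"
    using a Bword_prefix_unique by (intro the_equality) auto
  then show ?thesis using a by (auto simp: glue_def)
qed

lemma internal_not_leaf: "internal T w \<Longrightarrow> a < num T \<Longrightarrow> w \<noteq> Bword T a"
  unfolding internal_def using Bword_prefix_unique by (metis prefix_order.less_le)

lemma glue_internal: "internal T w \<Longrightarrow> glue T (w, s) = ((w, s), [])"
  using internal_not_leaf by (auto simp: glue_def)

lemma internal_Nil: "internal T []"
proof -
  have "0 < num T" using T by (simp add: is_slow_cf_def)
  then show ?thesis using Bword_nonempty[of 0] unfolding internal_def
    by (metis Nil_prefix prefix_order.less_le)
qed

lemma prefix_internal_or_leaf:
  "a < num T \<Longrightarrow> prefix w (Bword T a) \<Longrightarrow> internal T w \<or> w = Bword T a"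
  unfolding internal_def by (metis prefix_order.less_le)

lemma states_iff: "(w, s) \<in> states T \<longleftrightarrow> internal T w"
proof
  assume "(w, s) \<in> states T"
  then obtain v t a where v: "(w, s) = fst (glue T (v, t))" "a < num T" "prefix v (Bword T a)"
    by (auto simp: states_def)
  from prefix_internal_or_leaf[OF v(2,3)] show "internal T w"
    using v(1,2) internal_Nil by (auto simp: glue_internal glue_leaf)
next
  assume i: "internal T w"
  then obtain a where "a < num T" "prefix w (Bword T a)"
    unfolding internal_def by (metis prefix_order.less_le)
  moreover have "(w, s) = fst (glue T (w, s))" using i by (simp add: glue_internal)
  ultimately show "(w, s) \<in> states T" unfolding states_def by blast
qed

text \<open>Completeness of the prefix code. The coding of an irrational point that starts with
  \<open>w @ [x]\<close> passes some leaf. A leaf not longer than \<open>w\<close> would be a prefix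
  of a leaf properly extending \<open>w\<close>, hence equal to it, which is absurd.\<close>

lemma internal_extend:
  assumes "internal T w"
  shows "internal T (w @ [x]) \<or> (\<exists>a<num T. w @ [x] = Bword T a)"
proof -
  obtain a where a: "a < num T" "strict_prefix w (Bword T a)" using assms by (auto simp: internal_def)
  define z where "z = word_act (w @ [x]) (sqrt 2)"
  have z: "z \<in> pos_irrationals" "code z (length (w @ [x])) = w @ [x]"
    unfolding z_def using sqrt2_pos_irrational code_word_act[OF sqrt2_pos_irrational, of "w @ [x]"]
    by (simp_all only: word_act_irrational)
  obtain b where b: "b < num T" "code z (length (Bword T b)) = Bword T b" using exists_branch[OF z(1)] by blast
  show ?thesis
  proof (cases "length (w @ [x]) \<le> length (Bword T b)")
    case True
    then show ?thesis using prefix_of_common_code[OF z(2) b(2)] prefix_internal_or_leaf b(1) by blast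
  next
    case False
    hence "prefix (Bword T b) w" using prefix_of_common_code[OF b(2) z(2)] by auto
    hence "prefix (Bword T b) (Bword T a)" using a(2) by (metis prefix_order.less_le prefix_order.trans)
    hence "b = a" using Bword_prefix_unique a b by blast
    then show ?thesis using \<open>prefix (Bword T b) w\<close> a(2) by (metis prefix_order.less_le_not_le)
  qed
qed

lemma glue_in_states: "internal T w \<Longrightarrow> fst (glue T (w @ [x], s)) \<in> states T"
  using internal_extend[of w x] internal_Nil
  by (auto simp: glue_internal glue_leaf states_iff)

lemma transition_in_states: "u \<in> states T \<Longrightarrow> fst (transition T u x) \<in> states T"
  by (cases u) (auto simp: transition_def states_iff intro!: glue_in_states)

text \<open>Inside the tree a letter merely moves from the unread input into the node and the point
  stays the same; T is applied once when a leaf is reached. So h is 0 or 1.\<close>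

lemma transition_orbit:
  assumes u: "u \<in> states T" and z: "z \<in> pos_irrationals"
  shows "\<exists>h. (cf_map T ^^ h) (ereal (point u z)) = ereal (point (fst (transition T u (digit z))) (farey z))"
proof (cases u)
  case (Pair w s)
  define y where "y = farey z"
  define w' where "w' = w @ [if s then swap_letter (digit z) else digit z]"
  have y: "y \<in> pos_irrationals" "z = letter_act (digit z) y"
    using z by (simp_all add: y_def letter_act_digit)
  hence fl: "flip s z = letter_act (if s then swap_letter (digit z) else digit z) (flip s y)"
    using flip_letter_act[of y s "digit z"] by (simp add: pos_irrationals_def)
  have pt: "point u z = word_act w' (flip s y)"
    unfolding point_def Pair w'_def by (simp add: fl)
  have tr: "transition T u (digit z) = glue T (w', s)" by (simp add: Pair transition_def w'_def)
  from internal_extend[of w] u Pair have "internal T w' \<or> (\<exists>a<num T. w' = Bword T a)"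
    by (simp add: states_iff w'_def)
  then show ?thesis
  proof
    assume "internal T w'"
    then show ?thesis using pt tr
      by (intro exI[of _ 0]) (simp add: glue_internal point_def y_def)
  next
    assume "\<exists>a<num T. w' = Bword T a"
    then obtain a where a: "a < num T" "w' = Bword T a" by blast
    have "cf_map T (ereal (point u z)) = ereal (flip (expo T a) (flip s y))"
      unfolding pt a(2) using y a by (intro cf_map_word_act) auto
    also have "\<dots> = ereal (point (fst (transition T u (digit z))) y)"
      using a by (cases s; cases "expo T a") (simp_all add: tr glue_leaf point_def flip_flip)
    finally show ?thesis by (intro exI[of _ 1]) (simp add: y_def)
  qed
qed

lemma run_orbit:
  assumes "u \<in> states T" "z \<in> pos_irrationals"
  shows "\<exists>h. (cf_map T ^^ h) (ereal (point u z)) = ereal (point (run T u (code z k)) ((farey ^^ k) z))"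
  using assms
proof (induction k arbitrary: u z)
  case 0
  then show ?case by (intro exI[of _ 0]) simp
next
  case (Suc k)
  define u' where "u' = fst (transition T u (digit z))"
  have "u' \<in> states T" "farey z \<in> pos_irrationals"
    using Suc.prems by (simp_all add: u'_def transition_in_states)
  from Suc.IH[OF this] obtain h' where h': "(cf_map T ^^ h') (ereal (point u' (farey z)))
      = ereal (point (run T u' (code (farey z) k)) ((farey ^^ k) (farey z)))" by (elim exE)
  from transition_orbit[OF Suc.prems] obtain h
    where h: "(cf_map T ^^ h) (ereal (point u z)) = ereal (point u' (farey z))"
    unfolding u'_def by (elim exE)
  have "(cf_map T ^^ (h' + h)) (ereal (point u z)) = (cf_map T ^^ h') ((cf_map T ^^ h) (ereal (point u z)))"
    by (simp only: funpow_add o_apply)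
  also have "\<dots> = ereal (point (run T u (code z (Suc k))) ((farey ^^ Suc k) z))"
    unfolding h h' by (simp only: run_Cons code.simps u'_def funpow_Suc_right o_apply)
  finally show ?case by (rule exI)
qed

subsection \<open>The component of the root\<close>

lemma edges_in_states:
  assumes "(u, v) \<in> edges T" shows "u \<in> states T" "v \<in> states T"
proof -
  obtain x where "u \<in> states T" "v = fst (transition T u x)"
    using assms unfolding edges_def by blast
  then show "u \<in> states T" "v \<in> states T" by (simp_all only: transition_in_states)
qed

lemma root_in_states: "([], s) \<in> states T"
  by (simp add: states_iff internal_Nil)

lemma component_subset_states: "root_component T \<subseteq> states T"
proof
  fix v assume "v \<in> root_component T"
  hence "(([], False), v) \<in> (edges T \<union> (edges T)\<inverse>)\<^sup>*" by (simp add: root_component_def)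
  thus "v \<in> states T"
  proof (induction rule: rtrancl_induct)
    case base
    show ?case by (rule root_in_states)
  next
    case (step y z)
    then have "(y, z) \<in> edges T \<or> (z, y) \<in> edges T" by blast
    then show ?case using edges_in_states by metis
  qed
qed

lemma component_edge: "u \<in> root_component T \<Longrightarrow> (u, v) \<in> (edges T)\<^sup>* \<Longrightarrow> v \<in> root_component T"
  unfolding root_component_def mem_Collect_eq
  by (erule rtrancl_trans) (erule rtrancl_mono[THEN subsetD, rotated], simp)

lemma transition_in_component:
  assumes "u \<in> root_component T" shows "fst (transition T u x) \<in> root_component T"
proof -
  have "u \<in> states T" using assms component_subset_states by (rule subsetD[rotated])
  hence "(u, fst (transition T u x)) \<in> edges T" by (auto simp: edges_def)
  then show ?thesis by (intro component_edge[OF assms] r_into_rtrancl)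
qed

lemma run_in_component: "u \<in> root_component T \<Longrightarrow> run T u W \<in> root_component T"
  by (induction W arbitrary: u) (simp_all only: run_Nil run_Cons transition_in_component)

lemma root_reaches:
  assumes "a < num T" "prefix w (Bword T a)"
  shows "(([], s), fst (glue T (w, s))) \<in> (edges T)\<^sup>*"
  using assms(2)
proof (induction w rule: rev_induct)
  case Nil
  then show ?case by (simp add: glue_internal internal_Nil)
next
  case (snoc x w)
  have "strict_prefix w (Bword T a)"
    using snoc.prems by (auto simp: strict_prefix_def elim: prefixE)
  hence i: "internal T w" using assms(1) by (auto simp: internal_def)
  \<comment> \<open>The input letter to be fed in: the swap in \<open>transition\<close> undoes the
    swap made here.\<close>
  define l where "l = (if s then swap_letter x else x)"
  have "(if s then swap_letter l else l) = x" unfolding l_def by (cases x) auto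
  hence "transition T (w, s) l = glue T (w @ [x], s)" by (simp add: transition_def)
  hence "((w, s), fst (glue T (w @ [x], s))) \<in> edges T"
    using i unfolding edges_def mem_Collect_eq case_prod_conv states_iff by (intro conjI exI[of _ l]) simp_all
  moreover have "(([], s), (w, s)) \<in> (edges T)\<^sup>*"
    using snoc.IH snoc.prems i by (simp add: glue_internal append_prefixD)
  ultimately show ?case by (rule rtrancl_into_rtrancl[rotated])
qed

text \<open>If all exponents vanish, the twin bit is constant along edges and the root is not
  connected to its twin. One branch with e(a) = 1 leads from the root to its twin, and every state
  is reachable from one of the two.\<close>

lemma component_eq_states_iff: "root_component T = states T \<longleftrightarrow> (\<exists>a<num T. expo T a)"
proof
  assume eq: "root_component T = states T"
  show "\<exists>a<num T. expo T a"
  proof (rule ccontr)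
    assume no: "\<not> (\<exists>a<num T. expo T a)"
    have same: "snd v = snd u" if uv: "(u, v) \<in> edges T" for u v
    proof (cases u)
      case (Pair w s)
      obtain x where x: "internal T w" "v = fst (glue T (w @ [x], s))"
        using uv Pair by (auto simp: edges_def states_iff transition_def)
      then show ?thesis using internal_extend[OF x(1), of x] no Pair
        by (auto simp: glue_internal glue_leaf)
    qed
    have "(([], False), ([], True)) \<in> (edges T \<union> (edges T)\<inverse>)\<^sup>*"
      using eq root_in_states[of True] by (auto simp: root_component_def)
    hence "snd ([] :: letter list, True) = False"
      by (induction rule: rtrancl_induct) (auto dest: same)
    thus False by simp
  qed
next
  assume "\<exists>a<num T. expo T a"
  then obtain a where a: "a < num T" "expo T a" by blast
  have "([], s) \<in> root_component T" for s
  proof (cases s)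
    case True
    have "(([], False), ([], True)) \<in> (edges T)\<^sup>*"
      using root_reaches[OF a(1), of "Bword T a" False] a by (simp add: glue_leaf)
    then show ?thesis using component_edge[OF root_in_component] True by simp
  qed (simp add: root_in_component)
  hence "states T \<subseteq> root_component T"
    using root_reaches component_edge unfolding states_def by blast
  then show "root_component T = states T" using component_subset_states by blast
qed

end

subsection \<open>The group generated by the branches\<close>

abbreviation centre :: "(int^2^2) set" where "centre \<equiv> {mat 1, - mat 1}"

lemma group_GL2Z: "group GL2Z"
proof (rule groupI)
  fix x assume "x \<in> carrier GL2Z"
  then have "\<bar>det x\<bar> = 1" by (simp add: GL2Z_def)
  then obtain y where "y ** x = mat 1" "det y = det x" using invertible_int_mat2 by metis
  then show "\<exists>y\<in>carrier GL2Z. y \<otimes>\<^bsub>GL2Z\<^esub> x = \<one>\<^bsub>GL2Z\<^esub>"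
    using \<open>\<bar>det x\<bar> = 1\<close> by (intro bexI[of _ y]) (simp_all add: GL2Z_def)
qed (simp_all add: GL2Z_def det_mul abs_mult matrix_mul_assoc)

lemma det_inv_GL2Z:
  assumes "x \<in> carrier GL2Z" shows "det (inv\<^bsub>GL2Z\<^esub> x) = det x"
proof -
  interpret group GL2Z by (rule group_GL2Z)
  have d: "\<bar>det x\<bar> = 1" using assms by (simp add: GL2Z_def)
  have "inv\<^bsub>GL2Z\<^esub> x ** x = mat 1" using l_inv[OF assms] by (simp add: GL2Z_def)
  hence "det (inv\<^bsub>GL2Z\<^esub> x) * det x = 1" using arg_cong[of _ _ det] by (metis det_I det_mul)
  moreover have "det x = 1 \<or> det x = -1" using d by linarith
  ultimately show ?thesis by auto
qed

lemma minus_mat1: "(- mat 1) ** M = - M" "M ** (- mat 1) = - M" for M :: "int^2^2"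
  by (simp_all add: vec_eq_iff forall_2 matrix_matrix_mult_def sum_2 mat_def)

text \<open>In even dimension the sign is harmless, so the determinant is well defined on PGL and
  tells membership in PSL.\<close>

lemma det_minus_mat2: "det (- M) = det M" for M :: "int^2^2"
  by (simp add: det_2)

lemma pgl_eq: "pgl M = {M, - M}"
  by (auto simp: pgl_def r_coset_def GL2Z_def minus_mat1)

lemma normal_centre: "centre \<lhd> GL2Z"
proof -
  interpret group GL2Z by (rule group_GL2Z)
  have inv: "inv\<^bsub>GL2Z\<^esub> (- mat 1) = - mat 1"
    by (rule inv_equality) (simp_all add: GL2Z_def minus_mat1 det_minus_mat2)
  have one: "\<one>\<^bsub>GL2Z\<^esub> = mat 1" by (simp add: GL2Z_def)
  have "subgroup centre GL2Z"
  proof (rule subgroupI)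
    fix a assume "a \<in> centre"
    then show "inv\<^bsub>GL2Z\<^esub> a \<in> centre" using inv inv_one by (auto simp: one)
  next
    fix a b assume "a \<in> centre" "b \<in> centre"
    then show "a \<otimes>\<^bsub>GL2Z\<^esub> b \<in> centre" by (auto simp: GL2Z_def minus_mat1)
  qed (auto simp: GL2Z_def det_minus_mat2)
  then show ?thesis
  proof (rule normalI[rule_format])
    fix x assume "x \<in> carrier GL2Z"
    show "centre #>\<^bsub>GL2Z\<^esub> x = x <#\<^bsub>GL2Z\<^esub> centre"
      by (auto simp: r_coset_def l_coset_def GL2Z_def minus_mat1)
  qed
qed

lemma group_hom_pgl: "group_hom GL2Z PGL2Z pgl"
proof -
  interpret normal centre GL2Z by (rule normal_centre)
  show ?thesis
    unfolding group_hom_def group_hom_axioms_def PGL2Z_def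
    using group_GL2Z factorgroup_is_group r_coset_hom_Mod
    by (simp add: pgl_def[abs_def])
qed

lemma subgroup_PSL2Z: "subgroup PSL2Z PGL2Z"
proof -
  interpret group GL2Z by (rule group_GL2Z)
  have "subgroup {M. det M = 1} GL2Z"
  proof (rule subgroupI)
    show "{M :: int^2^2. det M = 1} \<subseteq> carrier GL2Z" by (auto simp: GL2Z_def)
    show "{M :: int^2^2. det M = 1} \<noteq> {}" using det_I by blast
  next
    fix a :: "int^2^2" assume "a \<in> {M. det M = 1}"
    then show "inv\<^bsub>GL2Z\<^esub> a \<in> {M. det M = 1}" using det_inv_GL2Z[of a] by (simp add: GL2Z_def)
  next
    fix a b :: "int^2^2" assume "a \<in> {M. det M = 1}" "b \<in> {M. det M = 1}"
    then show "a \<otimes>\<^bsub>GL2Z\<^esub> b \<in> {M. det M = 1}" by (simp add: GL2Z_def det_mul)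
  qed
  then show ?thesis unfolding PSL2Z_def by (rule group_hom.subgroup_img_is_subgroup[OF group_hom_pgl])
qed

lemma pgl_in_PSL2Z_iff: "pgl M \<in> PSL2Z \<longleftrightarrow> det M = 1"
proof
  assume "pgl M \<in> PSL2Z"
  then obtain M' where "det M' = 1" "{M, - M} = {M', - M'}" by (auto simp: PSL2Z_def pgl_eq)
  then show "det M = 1" using det_minus_mat2 by (metis insertI1 insertE singletonD)
qed (simp add: PSL2Z_def)

lemma pgl_branch_carrier: "pgl (branch T a) \<in> carrier PGL2Z"
proof -
  have "branch T a \<in> carrier GL2Z" by (simp add: GL2Z_def det_branch)
  then show ?thesis using group_hom.hom_closed[OF group_hom_pgl] by blast
qed

lemma Sigma_subset_PSL2Z_iff: "Sigma_grp T \<subseteq> PSL2Z \<longleftrightarrow> (\<forall>a<num T. \<not> expo T a)"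
proof
  assume sub: "Sigma_grp T \<subseteq> PSL2Z"
  show "\<forall>a<num T. \<not> expo T a"
  proof (intro allI impI)
    fix a assume "a < num T"
    hence "pgl (branch T a) \<in> Sigma_grp T" unfolding Sigma_grp_def by (intro generate.incl) auto
    hence "det (branch T a) = 1" using sub pgl_in_PSL2Z_iff by blast
    then show "\<not> expo T a" by (auto simp: det_branch)
  qed
next
  assume e: "\<forall>a<num T. \<not> expo T a"
  interpret group PGL2Z using group_hom_pgl by (simp add: group_hom_def)
  show "Sigma_grp T \<subseteq> PSL2Z" unfolding Sigma_grp_def
    using e by (intro generate_subgroup_incl subgroup_PSL2Z) (auto simp: pgl_in_PSL2Z_iff det_branch)
qed

lemma Sigma_abs_det:
  assumes "S \<in> Sigma_grp T" "M \<in> S"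
  shows "\<bar>det M\<bar> = 1"
proof -
  interpret group PGL2Z using group_hom_pgl by (simp add: group_hom_def)
  have "S \<in> carrier PGL2Z"
    using assms(1) unfolding Sigma_grp_def by (rule generate_in_carrier[rotated]) (auto simp: pgl_branch_carrier)
  then obtain M' where "\<bar>det M'\<bar> = 1" "S = pgl M'"
    by (auto simp: PGL2Z_def FactGroup_def RCOSETS_def pgl_def GL2Z_def)
  then show ?thesis using assms(2) by (auto simp: pgl_eq det_minus_mat2)
qed

lemma Sigma_det:
  assumes "S \<in> Sigma_grp T" "M \<in> S" "\<forall>a<num T. \<not> expo T a"
  shows "det M = 1"
proof -
  have "S \<in> PSL2Z" using assms Sigma_subset_PSL2Z_iff by blast
  then show ?thesis using assms(2) by (auto simp: PSL2Z_def pgl_eq det_minus_mat2)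
qed

subsection \<open>Tail equivalence\<close>

lemma tail_equiv_sym: "(\<alpha>, \<beta>) \<in> tail_equiv T \<Longrightarrow> (\<beta>, \<alpha>) \<in> tail_equiv T"
  unfolding tail_equiv_def by (auto; metis)

lemma tail_equiv_trans:
  assumes "(\<alpha>, \<beta>) \<in> tail_equiv T" "(\<beta>, \<gamma>) \<in> tail_equiv T"
  shows "(\<alpha>, \<gamma>) \<in> tail_equiv T"
proof -
  let ?s = "\<lambda>x. symbolic_orbit T (ereal x)"
  obtain h k where 1: "\<And>t. ?s \<alpha> (h + t) = ?s \<beta> (k + t)" using assms by (auto simp: tail_equiv_def)
  obtain i j where 2: "\<And>t. ?s \<beta> (i + t) = ?s \<gamma> (j + t)" using assms by (auto simp: tail_equiv_def)
  \<comment> \<open>Both relations are shifted so that they meet at the positions k + i + t of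
    \<beta>.\<close>
  have "?s \<alpha> ((h + i) + t) = ?s \<gamma> ((j + k) + t)" for t
    using 1[of "i + t"] 2[of "k + t"] by (simp add: ac_simps)
  then show ?thesis using assms unfolding tail_equiv_def by blast
qed

lemma tail_equivI:
  assumes "\<alpha> \<in> pos_irrationals" "\<beta> \<in> pos_irrationals"
    and "(cf_map T ^^ h) (ereal \<alpha>) = (cf_map T ^^ k) (ereal \<beta>)"
  shows "(\<alpha>, \<beta>) \<in> tail_equiv T"
proof -
  have "(cf_map T ^^ (h + t)) (ereal \<alpha>) = (cf_map T ^^ (k + t)) (ereal \<beta>)" for t
    using assms(3) by (simp add: add.commute[of _ t] funpow_add)
  hence "\<exists>h k. \<forall>t. symbolic_orbit T (ereal \<alpha>) (h + t) = symbolic_orbit T (ereal \<beta>) (k + t)"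
    unfolding symbolic_orbit_def by metis
  then show ?thesis using assms unfolding tail_equiv_def by blast
qed

text \<open>Recurrence of \<open>W\<close> is asked of \<alpha> alone: \<beta> shares its tail up to
  F, and passing to a twin state lets both runs read the same letters.\<close>

lemma Sigma_equiv_imp_tail_equiv:
  assumes T: "is_slow_cf T"
    and sync: "\<And>u v. u \<in> root_component T \<Longrightarrow> v \<in> root_component T \<Longrightarrow> run T u W = run T v W"
    and inf: "\<And>k. \<alpha> \<notin> avoiding W k" and rel: "(\<alpha>, \<beta>) \<in> Sigma_equiv T"
  shows "(\<alpha>, \<beta>) \<in> tail_equiv T"
proof -
  note comp = run_in_component[OF T] component_subset_states[OF T]
  have \<alpha>: "\<alpha> \<in> pos_irrationals" and \<beta>: "\<beta> \<in> pos_irrationals" using rel by (auto simp: Sigma_equiv_def)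
  obtain S M where M: "S \<in> Sigma_grp T" "M \<in> S" "ereal \<beta> = proj_action M (ereal \<alpha>)"
    using rel by (auto simp: Sigma_equiv_def)
  define e where "e \<longleftrightarrow> det M = -1"
  have detM: "\<bar>det M\<bar> = 1" using Sigma_abs_det M by blast
  have "\<beta> = (M$1$1 * \<alpha> + M$1$2) / (M$2$1 * \<alpha> + M$2$2)"
    using M(3) proj_action_irrational(1)[of \<alpha> M] \<alpha> detM by (auto simp: pos_irrationals_def)
  then obtain k Q where Q: "\<beta> = word_act Q (flip e ((farey ^^ k) \<alpha>))"
    using common_tail[OF \<alpha>, of \<beta> "M$1$1" "M$1$2" "M$2$1" "M$2$2"] detM \<beta>
    unfolding e_def by (auto simp: det_2 pos_irrationals_def)
  define \<xi> where "\<xi> = (farey ^^ k) \<alpha>"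
  have \<xi>: "\<xi> \<in> pos_irrationals" using \<alpha> by (simp add: \<xi>_def)
  define u where "u = run T ([], False) (code \<alpha> k)"
  define v where "v = run T ([], False) Q"
  \<comment> \<open>The F in front of the tail of \<beta> is absorbed into the state, which becomes
    its twin; the input is then the coding of \<xi> for both runs.\<close>
  define v' where "v' = (fst v, snd v \<noteq> e)"
  note root = root_in_component[of T]
  have u: "u \<in> root_component T" and v: "v \<in> root_component T"
    unfolding u_def v_def by (rule comp(1)[OF root])+
  have v': "v' \<in> root_component T"
  proof (cases e)
    case True
    \<comment> \<open>Determinant -1 forces an orientation-reversing branch; then the component is
      all of \<open>states T\<close>, which is closed under twins.\<close>
    hence "\<exists>a<num T. expo T a" using Sigma_det[OF M(1,2)] by (auto simp: e_def)
    hence all: "root_component T = states T" using component_eq_states_iff[OF T] by blast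
    have "internal T (fst v)" using v all states_iff[OF T, of "fst v" "snd v"] by simp
    then show ?thesis unfolding all v'_def using states_iff[OF T] by blast
  next
    case False
    then show ?thesis using v by (simp add: v'_def)
  qed
  have init: "point ([], False) x = x" for x by (simp add: point_def flip_def)
  obtain h where h: "(cf_map T ^^ h) (ereal \<alpha>) = ereal (point u \<xi>)"
    using run_orbit[OF T root_in_states[OF T] \<alpha>, of False k]
    unfolding u_def \<xi>_def init by (elim exE)
  have cQ: "code \<beta> (length Q) = Q" "(farey ^^ length Q) \<beta> = flip e \<xi>"
    using code_word_act[of "flip e \<xi>" Q] \<xi> Q by (simp_all add: \<xi>_def)
  obtain h' where "(cf_map T ^^ h') (ereal \<beta>) = ereal (point v (flip e \<xi>))"
    using run_orbit[OF T root_in_states[OF T] \<beta>, of False "length Q"]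
    unfolding v_def init cQ by (elim exE)
  also have "point v (flip e \<xi>) = point v' \<xi>" by (simp add: point_def v'_def flip_flip)
  finally have h': "(cf_map T ^^ h') (ereal \<beta>) = ereal (point v' \<xi>)" .
  \<comment> \<open>An occurrence of \<open>W\<close> from position \<open>k\<close> on lies in the
    common tail \<xi>.\<close>
  obtain j where "k \<le> j" "code ((farey ^^ j) \<alpha>) (length W) = W"
    using inf[of k] \<alpha> by (auto simp: avoiding_def)
  then obtain i where i: "code ((farey ^^ i) \<xi>) (length W) = W"
    unfolding \<xi>_def by (metis add.commute comp_apply funpow_add le_add_diff_inverse)
  define n where "n = i + length W"
  have cn: "code \<xi> n = code \<xi> i @ W" unfolding n_def by (simp add: code_add i)
  have "run T u (code \<xi> n) = run T v' (code \<xi> n)"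
    unfolding cn run_append using u v' by (intro sync comp(1))
  moreover obtain m where "(cf_map T ^^ m) (ereal (point u \<xi>)) = ereal (point (run T u (code \<xi> n)) ((farey ^^ n) \<xi>))"
    using run_orbit[OF T subsetD[OF comp(2) u] \<xi>] by blast
  moreover obtain m' where "(cf_map T ^^ m') (ereal (point v' \<xi>)) = ereal (point (run T v' (code \<xi> n)) ((farey ^^ n) \<xi>))"
    using run_orbit[OF T subsetD[OF comp(2) v'] \<xi>] by blast
  ultimately have "(cf_map T ^^ (m + h)) (ereal \<alpha>) = (cf_map T ^^ (m' + h')) (ereal \<beta>)"
    by (simp add: funpow_add h h')
  then show ?thesis by (rule tail_equivI[OF \<alpha> \<beta>])
qed

theorem theorem6p1:
  fixes T :: slow_cf
  assumes "is_slow_cf T"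
  shows "(root_component T = states T \<longleftrightarrow> \<not> Sigma_grp T \<subseteq> PSL2Z) \<and>
    (synchronizing T (root_component T) \<longrightarrow>
      {\<alpha> \<in> pos_irrationals.
         \<exists>C D. C \<in> (Sigma_equiv T `` {\<alpha>}) // tail_equiv T \<and>
               D \<in> (Sigma_equiv T `` {\<alpha>}) // tail_equiv T \<and> C \<noteq> D} \<in> null_sets lebesgue)"
proof (intro conjI impI)
  show "root_component T = states T \<longleftrightarrow> \<not> Sigma_grp T \<subseteq> PSL2Z"
    unfolding component_eq_states_iff[OF assms] Sigma_subset_PSL2Z_iff by blast
next
  assume "synchronizing T (root_component T)"
  then obtain W where W: "\<forall>u\<in>root_component T. \<forall>v\<in>root_component T. run T u W = run T v W"
    unfolding synchronizing_def by (elim exE)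
  let ?E = "{\<alpha> \<in> pos_irrationals.
         \<exists>C D. C \<in> (Sigma_equiv T `` {\<alpha>}) // tail_equiv T \<and>
               D \<in> (Sigma_equiv T `` {\<alpha>}) // tail_equiv T \<and> C \<noteq> D}"
  have "?E \<subseteq> (\<Union>k. avoiding W k)"
  proof (rule subsetI, rule ccontr)
    fix \<alpha> assume \<alpha>: "\<alpha> \<in> ?E" "\<alpha> \<notin> (\<Union>k. avoiding W k)"
    have *: "(\<alpha>, \<beta>) \<in> tail_equiv T" if rel: "(\<alpha>, \<beta>) \<in> Sigma_equiv T" for \<beta>
    proof (rule Sigma_equiv_imp_tail_equiv[where W = W])
      show "run T u W = run T v W" if "u \<in> root_component T" "v \<in> root_component T" for u v
        by (rule W[rule_format, OF that])
      show "\<alpha> \<notin> avoiding W k" for k using \<alpha>(2) by blast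
    qed (fact assms rel)+
    \<comment> \<open>Every member of the class of \<alpha> is tail equivalent to \<alpha> itself,
      so the quotient cannot contain two sets.\<close>
    have single: "X = tail_equiv T `` {\<alpha>}" if X: "X \<in> (Sigma_equiv T `` {\<alpha>}) // tail_equiv T" for X
    proof -
      obtain \<beta> where "\<beta> \<in> Sigma_equiv T `` {\<alpha>}" and X': "X = tail_equiv T `` {\<beta>}"
        by (rule quotientE[OF X])
      hence "(\<alpha>, \<beta>) \<in> Sigma_equiv T" by simp
      note \<alpha>\<beta> = *[OF this]
      have "(\<beta>, \<gamma>) \<in> tail_equiv T \<longleftrightarrow> (\<alpha>, \<gamma>) \<in> tail_equiv T" for \<gamma>
        using tail_equiv_trans[OF \<alpha>\<beta>, of \<gamma>] tail_equiv_trans[OF tail_equiv_sym[OF \<alpha>\<beta>], of \<gamma>] by (rule iffI)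
      then show ?thesis unfolding X' Image_singleton by simp
    qed
    from \<alpha>(1) show False
      unfolding mem_Collect_eq
    proof (elim conjE exE)
      fix C D assume CD: "C \<in> (Sigma_equiv T `` {\<alpha>}) // tail_equiv T"
        "D \<in> (Sigma_equiv T `` {\<alpha>}) // tail_equiv T" and "C \<noteq> D"
      then show False by (simp only: single[OF CD(1)] single[OF CD(2)])
    qed
  qed
  moreover have "(\<Union>k. avoiding W k) \<in> null_sets lborel"
    by (intro null_sets_UN avoiding_null)
  \<comment> \<open>The exceptional set is not shown to be Borel; it is Lebesgue null as a subset of
    a Borel null set.\<close>
  ultimately show "?E \<in> null_sets lebesgue"
    by (rule null_sets_completion_subset[OF _ null_sets_completionI])
qed

end
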